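(* Let $c\ge1$ and let $\mathcal{M}$ be a class of matroids such that every matroid in $\mathcal{M}$ has a $c$-competitive matroid secretary algorithm. Let $k\in\mathbb{N}$ and let $t_k(\mathcal{M})$ be the set of all matroids $M$ having a full tree-decomposition $(T,\mathcal{X})$, $\mathcal{X}=\{X_v:v\in V(T)\}$, of thickness at most $k$ such that $M|\mathrm{cl}_M(X_v)\in\mathcal{M}$ for each $v\in V(T)$. Then every matroid in $t_k(\mathcal{M})$ has a $c(e+1)^k$-competitive matroid secretary algorithm (here $e$ is Euler's number).
   Context: For a matroid $M$ with rank function $r_M$ and disjoint $X,Y\subseteq E(M)$, $\sqcap_M(X,Y)=r_M(X)+r_M(Y)-r_M(X\cup Y)$ and $\lambda_M(X)=\sqcap_M(X,E(M)-X)$. A tree-decomposition of $M$ is a pair $(T,\mathcal{X})$ where $T$ is a tree and $\mathcal{X}=\{X_v:v\in V(T)\}$ is a partition of $E(M)$ indexed by $V(T)$. For an edge $f=v_1v_2$ of $T$, let $T_1$ be the component of $T\setminus f$ containing $v_1$ and $X_1=\bigcup_{v\in V(T_1)}X_v$; the thickness of $f$ is $\lambda(f)=\lambda_M(X_1)$. The thickness of $(T,\mathcal{X})$ is $\max_{f\in E(T)}\lambda(f)$. The tree-decomposition is full if $\sqcap_M(X_u,X_v)=\lambda(f)$ for every edge $f=uv$ of $T$. $\mathrm{cl}_M$ is the closure operator of $M$. Matroid secretary problem: a matroid $M$ with ground set $E$ is known in advance; an unknown weight function $w\colon E\to\mathbb{R}_{\ge 0}$ is given. The elements of $E$ are revealed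 one at a time in a uniformly random order; when an element $g$ is revealed, $w(g)$ is learned and the algorithm must irrevocably decide whether to select $g$, subject to the selected set always being independent in $M$. The algorithm may use internal randomness. The value of the algorithm on $(M,w)$ is the expected weight of the selected set (over the random order and internal randomness). $\mathrm{opt}(M,w)$ is the maximum weight of an independent set of $M$. For $c\ge1$, an algorithm is $c$-competitive for $M$ if its value is at least $\tfrac1c\mathrm{opt}(M,w)$ for every $w$. *)

theory Defs
  imports "HOL-Probability.Probability" "HOL-Combinatorics.Multiset_Permutations"
begin

section \<open>Matroids\<close>

record 'a matroid_system =
  ground :: "'a set"
  indep :: "'a set set"

definition matroid :: "'a matroid_system \<Rightarrow> bool" where
  "matroid M \<longleftrightarrow>
     finite (ground M) \<and>
     indep M \<subseteq> Pow (ground M) \<and>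
     {} \<in> indep M \<and>
     (\<forall>I J. I \<in> indep M \<longrightarrow> J \<subseteq> I \<longrightarrow> J \<in> indep M) \<and>
     (\<forall>I J. I \<in> indep M \<longrightarrow> J \<in> indep M \<longrightarrow> card I < card J \<longrightarrow>
        (\<exists>x\<in>J - I. insert x I \<in> indep M))"

definition rank :: "'a matroid_system \<Rightarrow> 'a set \<Rightarrow> nat" where
  "rank M X = Max (card ` {I \<in> indep M. I \<subseteq> X})"

definition cl :: "'a matroid_system \<Rightarrow> 'a set \<Rightarrow> 'a set" where
  "cl M X = {x \<in> ground M. rank M (insert x X) = rank M X}"

definition restriction :: "'a matroid_system \<Rightarrow> 'a set \<Rightarrow> 'a matroid_system" where
  "restriction M X = \<lparr>ground = ground M \<inter> X, indep = {I \<in> indep M. I \<subseteq> X}\<rparr>"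

text \<open>Integer-valued, so that the subtraction is not truncated.\<close>

definition local_conn :: "'a matroid_system \<Rightarrow> 'a set \<Rightarrow> 'a set \<Rightarrow> int" where
  "local_conn M X Y = int (rank M X) + int (rank M Y) - int (rank M (X \<union> Y))"

definition conn :: "'a matroid_system \<Rightarrow> 'a set \<Rightarrow> int" where
  "conn M X = local_conn M X (ground M - X)"

section \<open>Trees\<close>

text \<open>Undirected graphs are given by a vertex set \<open>V\<close> and a set \<open>F\<close> of two-element
  subsets of \<open>V\<close>.\<close>

definition simple_graph :: "'v set \<Rightarrow> 'v set set \<Rightarrow> bool" where
  "simple_graph V F \<longleftrightarrow> finite V \<and> (\<forall>f\<in>F. f \<subseteq> V \<and> card f = 2)"

definition component :: "'v set set \<Rightarrow> 'v \<Rightarrow> 'v set" where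
  "component F u = {v. (u, v) \<in> {(x, y). {x, y} \<in> F}\<^sup>*}"

definition is_cycle :: "'v set set \<Rightarrow> 'v list \<Rightarrow> bool" where
  "is_cycle F vs \<longleftrightarrow> 3 \<le> length vs \<and> distinct vs \<and>
     (\<forall>i<length vs. {vs ! i, vs ! (Suc i mod length vs)} \<in> F)"

definition is_tree :: "'v set \<Rightarrow> 'v set set \<Rightarrow> bool" where
  "is_tree V F \<longleftrightarrow> simple_graph V F \<and> V \<noteq> {} \<and>
     (\<forall>u\<in>V. component F u = V) \<and> (\<nexists>vs. is_cycle F vs)"

section \<open>Tree-decompositions\<close>

text \<open>The parts are indexed by the vertices and may be empty.\<close>

definition tree_decomposition ::
  "'a matroid_system \<Rightarrow> 'v set \<Rightarrow> 'v set set \<Rightarrow> ('v \<Rightarrow> 'a set) \<Rightarrow> bool" where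
  "tree_decomposition M V F X \<longleftrightarrow>
     is_tree V F \<and> disjoint_family_on X V \<and> (\<Union>v\<in>V. X v) = ground M"

text \<open>The thickness of the edge \<open>{u, v}\<close>, computed from the side of \<open>u\<close>. For a
  tree-decomposition of a matroid the other side gives the same number, since the two
  sides partition the ground set.\<close>

definition edge_thickness ::
  "'a matroid_system \<Rightarrow> 'v set set \<Rightarrow> ('v \<Rightarrow> 'a set) \<Rightarrow> 'v \<Rightarrow> 'v \<Rightarrow> int" where
  "edge_thickness M F X u v = conn M (\<Union>x\<in>component (F - {{u, v}}) u. X x)"

text \<open>Connectivities in a matroid are nonnegative, so the inserted \<open>0\<close> only gives a value
  to the tree without edges.\<close>

definition thickness ::
  "'a matroid_system \<Rightarrow> 'v set set \<Rightarrow> ('v \<Rightarrow> 'a set) \<Rightarrow> int" where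
  "thickness M F X = Max (insert 0 {edge_thickness M F X u v |u v. {u, v} \<in> F})"

definition full_tree_decomposition ::
  "'a matroid_system \<Rightarrow> 'v set \<Rightarrow> 'v set set \<Rightarrow> ('v \<Rightarrow> 'a set) \<Rightarrow> bool" where
  "full_tree_decomposition M V F X \<longleftrightarrow> tree_decomposition M V F X \<and>
     (\<forall>u v. {u, v} \<in> F \<longrightarrow> local_conn M (X u) (X v) = edge_thickness M F X u v)"

text \<open>The class \<open>t_k(\<M>)\<close>. HOL cannot quantify over types inside a definition, so the type
  of tree vertices is a parameter; \<open>TYPE(nat)\<close> already covers all finite trees up to
  isomorphism.\<close>

definition t_class ::
  "'v itself \<Rightarrow> nat \<Rightarrow> 'a matroid_system set \<Rightarrow> 'a matroid_system set" where
  "t_class _ k \<M> = {M. matroid M \<and>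
     (\<exists>(V :: 'v set) F X. full_tree_decomposition M V F X \<and> thickness M F X \<le> int k \<and>
        (\<forall>v\<in>V. restriction M (cl M (X v)) \<in> \<M>))}"

section \<open>The matroid secretary problem\<close>

text \<open>A deterministic online algorithm maps the history (the elements revealed so far
  together with their weights, in order of arrival, the current element being the last
  entry) to the decision whether to select the current element. Its own earlier decisions
  are functions of the history and need not be recorded.\<close>

type_synonym 'a online_alg = "('a \<times> real) list \<Rightarrow> bool"

definition selected :: "'a online_alg \<Rightarrow> ('a \<Rightarrow> real) \<Rightarrow> 'a list \<Rightarrow> 'a set" where
  "selected A w \<sigma> =
     {\<sigma> ! i |i. i < length \<sigma> \<and> A (map (\<lambda>x. (x, w x)) (take (Suc i) \<sigma>))}"

definition weighting :: "'a matroid_system \<Rightarrow> ('a \<Rightarrow> real) \<Rightarrow> bool" where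
  "weighting M w \<longleftrightarrow> (\<forall>x\<in>ground M. 0 \<le> w x)"

text \<open>The final selection being independent forces every intermediate selection to be
  independent as well.\<close>

definition feasible :: "'a matroid_system \<Rightarrow> 'a online_alg \<Rightarrow> bool" where
  "feasible M A \<longleftrightarrow> (\<forall>w \<sigma>. weighting M w \<longrightarrow> \<sigma> \<in> permutations_of_set (ground M) \<longrightarrow>
     selected A w \<sigma> \<in> indep M)"

text \<open>A randomized algorithm is a probability measure on a set of feasible deterministic
  algorithms for which every single decision is a random variable. An algorithm
  \<open>\<omega> \<mapsto> A \<omega>\<close> using an arbitrary probability space as its source of internal randomness
  induces such a measure as its image.\<close>

definition secretary_alg :: "'a matroid_system \<Rightarrow> 'a online_alg measure \<Rightarrow> bool" where
  "secretary_alg M D \<longleftrightarrow> prob_space D \<and> (\<forall>A\<in>space D. feasible M A) \<and>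
     (\<forall>h. (\<lambda>A. A h) \<in> measurable D (count_space UNIV))"

text \<open>The order of arrival is uniform and independent of the internal randomness.\<close>

definition alg_value ::
  "'a matroid_system \<Rightarrow> 'a online_alg measure \<Rightarrow> ('a \<Rightarrow> real) \<Rightarrow> real" where
  "alg_value M D w =
     measure_pmf.expectation (pmf_of_set (permutations_of_set (ground M)))
       (\<lambda>\<sigma>. \<integral>A. (\<Sum>x\<in>selected A w \<sigma>. w x) \<partial>D)"

definition opt :: "'a matroid_system \<Rightarrow> ('a \<Rightarrow> real) \<Rightarrow> real" where
  "opt M w = Max ((\<lambda>I. \<Sum>x\<in>I. w x) ` indep M)"

definition competitive :: "real \<Rightarrow> 'a matroid_system \<Rightarrow> 'a online_alg measure \<Rightarrow> bool" where
  "competitive c M D \<longleftrightarrow> secretary_alg M D \<and>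
     (\<forall>w. weighting M w \<longrightarrow> 1 / c * opt M w \<le> alg_value M D w)"

end

(* Order the vertices of the tree so that every vertex is joined to an earlier one. By fullness,
   contracting the parent part P has the same effect on the part X as contracting all earlier
   parts, so independent sets of these contractions can be combined freely. Reassign each element
   to the first part that spans it; then no element becomes a loop after contracting P. Running
   the given algorithm on the closure of a part (the other elements of the closure get weight 0
   but still arrive in the actual uniform order) and rejecting what is spanned over P costs at most
   k elements, each of weight at most the maximum weight m of the part. To pay for this, with
   probability ek / (1 + ek) run the classical secretary rule on every part instead, which earns
   m / e. Altogether this is c (1 + ek)-competitive, and 1 + ek <= (1 + e)^k. *)
theory Submission
  imports Defs
begin

section \<open>Matroids\<close>

text \<open>The classical rule earns \<open>m / e\<close> on a piece only if the heaviest element of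
  the piece can be kept, which fails when the parent part spans it. This obstacle forces the
  reassignment; the new pieces leave the parts but stay inside their closures, and that is where
  algorithms are given. The loss per piece does not grow with the number of pieces: an independent
  subset of the closure of \<open>X\<close> loses at most the local connectivity of \<open>X\<close>
  and \<open>P\<close> when \<open>P\<close> is contracted, and by fullness this is the thickness of
  one tree edge. The mixing probability is a balance. If the given algorithms run with probability
  \<open>q\<close>, the expected loss \<open>q * k * m\<close> has to be matched by the secretary
  gain \<open>(1 - q) * m / e\<close>, which gives \<open>q = 1 / (1 + e * k)\<close>. Both branches
  treat all pieces simultaneously, so the tree enters only through the order of its vertices and the
  connectivity to the parent part.\<close>

context
  fixes M :: "'a matroid_system"
  assumes M: "matroid M"
begin

lemma finite_ground: "finite (ground M)"
  using M by (simp add: matroid_def)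

lemma indep_subset_ground: "I \<in> indep M \<Longrightarrow> I \<subseteq> ground M"
  using M by (auto simp: matroid_def)

lemma finite_indep: "finite (indep M)"
  using M finite_subset[of "indep M" "Pow (ground M)"] by (auto simp: matroid_def)

lemma indep_imp_finite: "I \<in> indep M \<Longrightarrow> finite I"
  using finite_ground indep_subset_ground finite_subset by blast

lemma empty_indep: "{} \<in> indep M"
  using M by (simp add: matroid_def)

lemma indep_mono: "I \<in> indep M \<Longrightarrow> J \<subseteq> I \<Longrightarrow> J \<in> indep M"
  using M by (auto simp: matroid_def)

section \<open>Rank, submodularity and closure\<close>

lemma card_le_rank: "I \<in> indep M \<Longrightarrow> I \<subseteq> X \<Longrightarrow> card I \<le> rank M X"
  unfolding rank_def using finite_indep by (intro Max_ge) auto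

lemma ex_basis: "\<exists>I\<in>indep M. I \<subseteq> X \<and> card I = rank M X"
proof -
  have "rank M X \<in> card ` {I \<in> indep M. I \<subseteq> X}"
    unfolding rank_def using finite_indep empty_indep by (intro Max_in) auto
  then show ?thesis by auto
qed

lemma extend_to_basis:
  assumes "I \<in> indep M" "I \<subseteq> X"
  shows "\<exists>B\<in>indep M. I \<subseteq> B \<and> B \<subseteq> X \<and> card B = rank M X"
  using assms
proof (induction "rank M X - card I" arbitrary: I)
  case 0
  then show ?case using card_le_rank[of I X] by (intro bexI[of _ I]) auto
next
  case (Suc d)
  obtain B where B: "B \<in> indep M" "B \<subseteq> X" "card B = rank M X" using ex_basis by blast
  with Suc.hyps have "card I < card B" by simp
  then obtain x where x: "x \<in> B - I" "insert x I \<in> indep M"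
    using M Suc.prems(1) B(1) unfolding matroid_def by blast
  have "d = rank M X - card (insert x I)"
    using x indep_imp_finite[OF Suc.prems(1)] Suc.hyps(2) by simp
  then obtain C where "C \<in> indep M" "insert x I \<subseteq> C" "C \<subseteq> X" "card C = rank M X"
    using Suc.hyps(1)[of "insert x I"] x B(2) Suc.prems(2) by blast
  then show ?case by blast
qed

lemma rank_mono: "X \<subseteq> Y \<Longrightarrow> rank M X \<le> rank M Y"
  using ex_basis[of X] card_le_rank[of _ Y] by (metis subset_trans)

lemma rank_le_card: "finite X \<Longrightarrow> rank M X \<le> card X"
  using ex_basis[of X] card_mono by metis

lemma rank_empty: "rank M {} = 0"
  using rank_le_card[of "{}"] by simp

lemma rank_indep: "I \<in> indep M \<Longrightarrow> rank M I = card I"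
  using card_le_rank[of I I] rank_le_card[of I] indep_imp_finite by force

lemma indep_if_rank: "finite X \<Longrightarrow> rank M X = card X \<Longrightarrow> X \<in> indep M"
  using ex_basis[of X] card_subset_eq by metis

text \<open>A basis of the intersection, extended to a basis \<open>K\<close> of the union, meets
  \<open>A\<close> and \<open>B\<close> in independent sets, and these two traces overlap at least
  in the original basis.\<close>

lemma rank_submodular: "rank M (A \<union> B) + rank M (A \<inter> B) \<le> rank M A + rank M B"
proof -
  obtain I where I: "I \<in> indep M" "I \<subseteq> A \<inter> B" "card I = rank M (A \<inter> B)"
    using ex_basis by blast
  obtain K where K: "K \<in> indep M" "I \<subseteq> K" "K \<subseteq> A \<union> B" "card K = rank M (A \<union> B)"
    using extend_to_basis[of I "A \<union> B"] I by blast
  have fin: "finite K" using K indep_imp_finite by blast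
  have "card (K \<inter> A) + card (K \<inter> B) = card (K \<inter> A \<union> K \<inter> B) + card (K \<inter> A \<inter> (K \<inter> B))"
    using fin by (intro card_Un_Int) auto
  moreover have "K \<inter> A \<union> K \<inter> B = K" using K by auto
  moreover have "card I \<le> card (K \<inter> A \<inter> (K \<inter> B))"
    using fin I K by (intro card_mono) auto
  moreover have "card (K \<inter> A) \<le> rank M A" "card (K \<inter> B) \<le> rank M B"
    using K indep_mono by (auto intro!: card_le_rank)
  ultimately show ?thesis using I K by simp
qed

text \<open>The working form: \<open>N\<close> only has to lie in the intersection, so intersections
  of unions never have to be computed.\<close>

lemma rank_submodular':
  "A \<union> B = U \<Longrightarrow> N \<subseteq> A \<Longrightarrow> N \<subseteq> B \<Longrightarrow> rank M U + rank M N \<le> rank M A + rank M B"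
  using rank_submodular[of A B] rank_mono[of N "A \<inter> B"] by auto

lemma rank_Un_le: "finite J \<Longrightarrow> rank M (J \<union> Z) \<le> card J + rank M Z"
  using rank_submodular[of J Z] rank_le_card[of J] by linarith

lemma rank_insert_not_cl:
  assumes "x \<in> ground M" "x \<notin> cl M X"
  shows "rank M (insert x X) = Suc (rank M X)"
  using assms rank_Un_le[of "{x}" X] rank_mono[of X "insert x X"] by (fastforce simp: cl_def)

lemma subset_cl: "X \<subseteq> ground M \<Longrightarrow> X \<subseteq> cl M X"
  by (auto simp: cl_def insert_absorb)

lemma cl_subset_ground: "cl M X \<subseteq> ground M"
  by (auto simp: cl_def)

text \<open>By submodularity an element raises the rank of a larger set by no more than it raises
  the rank of \<open>X\<close>, which is by nothing; the induction accumulates this over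
  \<open>Y\<close>.\<close>

lemma rank_Un_subset_cl:
  assumes "Y \<subseteq> cl M X" "X \<subseteq> Z"
  shows "rank M (Z \<union> Y) = rank M Z"
proof -
  have "finite Y"
    using assms(1) cl_subset_ground finite_ground by (meson finite_subset)
  then show ?thesis
    using assms
  proof (induction Y)
    case (insert y Y)
    have "rank M (insert y (Z \<union> Y)) + rank M X \<le> rank M (Z \<union> Y) + rank M (insert y X)"
      using insert.prems by (intro rank_submodular') auto
    moreover have "rank M (insert y X) = rank M X"
      using insert.prems by (auto simp: cl_def)
    moreover have "rank M (Z \<union> Y) \<le> rank M (insert y (Z \<union> Y))"
      by (intro rank_mono) auto
    ultimately show ?case using insert by simp
  qed auto
qed

lemma cl_mono: "X \<subseteq> Z \<Longrightarrow> cl M X \<subseteq> cl M Z"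
  using rank_Un_subset_cl[of "{_}" X Z] by (auto simp: cl_def)

section \<open>Local connectivity and independence over earlier parts\<close>

lemma local_conn_commute: "local_conn M X Y = local_conn M Y X"
  by (simp add: local_conn_def Un_commute)

lemma local_conn_mono_left: "X \<subseteq> X' \<Longrightarrow> local_conn M X Y \<le> local_conn M X' Y"
proof -
  assume "X \<subseteq> X'"
  then have "rank M (X' \<union> Y) + rank M X \<le> rank M (X \<union> Y) + rank M X'"
    by (intro rank_submodular') auto
  then show "local_conn M X Y \<le> local_conn M X' Y" by (simp add: local_conn_def)
qed

lemma local_conn_mono:
  "X \<subseteq> X' \<Longrightarrow> Y \<subseteq> Y' \<Longrightarrow> local_conn M X Y \<le> local_conn M X' Y'"
  using local_conn_mono_left[of X X' Y] local_conn_mono_left[of Y Y' X']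
  by (simp add: local_conn_commute)

text \<open>Equal local connectivity means that contracting \<open>E\<close> and contracting its subset \<open>P\<close>
  induce the same matroid on \<open>cl M X\<close>.\<close>

lemma rank_over_superset:
  assumes "P \<subseteq> E" "local_conn M X E = local_conn M X P"
    and "J \<subseteq> cl M X" "rank M (J \<union> P) = card J + rank M P"
  shows "rank M (J \<union> E) = card J + rank M E"
proof -
  have fin: "finite J"
    using assms(3) cl_subset_ground finite_ground by (meson finite_subset)
  \<comment> \<open>The two sets on the right have union \<open>X \<union> E \<union> J\<close> and
    both contain \<open>J \<union> P\<close>. Since \<open>J\<close> is spanned by \<open>X\<close>,
    what remains is \<open>rank M (X \<union> E) - rank M (X \<union> P)\<close>, and the
    connectivity hypothesis makes this \<open>rank M E - rank M P\<close>.\<close>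
  have "rank M (X \<union> E \<union> J) + rank M (J \<union> P) \<le> rank M (J \<union> E) + rank M (X \<union> P \<union> J)"
    using assms(1) by (intro rank_submodular') auto
  moreover have "rank M (X \<union> E \<union> J) = rank M (X \<union> E)" "rank M (X \<union> P \<union> J) = rank M (X \<union> P)"
    using assms(3) by (auto intro!: rank_Un_subset_cl)
  moreover have "rank M (J \<union> E) \<le> card J + rank M E"
    by (rule rank_Un_le[OF fin])
  ultimately show ?thesis using assms(2,4) by (simp add: local_conn_def)
qed

text \<open>A set that is independent over all earlier parts is independent over the union of the
  earlier \<open>J i\<close>, because these parts span that union. Independent sets of the
  successive contractions therefore join up.\<close>

lemma indep_UN_over:
  fixes X :: "nat \<Rightarrow> 'a set"
  assumes "\<And>i. i < n \<Longrightarrow> J i \<subseteq> cl M (X i)"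
    and "\<And>i. i < n \<Longrightarrow> rank M (J i \<union> (\<Union>j<i. X j)) = card (J i) + rank M (\<Union>j<i. X j)"
  shows "(\<Union>i<n. J i) \<in> indep M"
  using assms
proof (induction n)
  case 0
  then show ?case by (simp add: empty_indep)
next
  case (Suc n)
  let ?K = "\<Union>i<n. J i" and ?E = "\<Union>j<n. X j"
  have K: "?K \<in> indep M" using Suc by simp
  have fin: "finite (J n)"
    using Suc.prems(1)[of n] cl_subset_ground finite_ground by (meson finite_subset lessI)
  have "?K \<subseteq> cl M ?E"
  proof
    fix x assume "x \<in> ?K"
    then obtain i where i: "i < n" "x \<in> J i" by auto
    then have "X i \<subseteq> ?E" "x \<in> cl M (X i)" using Suc.prems(1)[of i] by auto
    then show "x \<in> cl M ?E" using cl_mono by blast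
  qed
  then have "rank M (?E \<union> ?K) = rank M ?E"
    by (intro rank_Un_subset_cl) auto
  \<comment> \<open>Submodularity moves the contraction down from \<open>?E \<union> ?K\<close> to
    \<open>?K\<close>: the rank gained by adding \<open>J n\<close> can only increase.\<close>
  moreover have "rank M (?E \<union> ?K \<union> J n) + rank M ?K \<le> rank M (?K \<union> J n) + rank M (?E \<union> ?K)"
    by (intro rank_submodular') auto
  moreover have "rank M (J n \<union> ?E) \<le> rank M (?E \<union> ?K \<union> J n)"
    by (intro rank_mono) auto
  moreover have "rank M (J n \<union> ?E) = card (J n) + rank M ?E"
    using Suc.prems(2)[of n] by simp
  moreover have "rank M ?K = card ?K" using K rank_indep by simp
  ultimately have ge: "card ?K + card (J n) \<le> rank M (?K \<union> J n)" by simp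
  have "rank M (?K \<union> J n) \<le> card (?K \<union> J n)"
    using fin indep_imp_finite[OF K] by (intro rank_le_card) auto
  then have "rank M (?K \<union> J n) = card (?K \<union> J n)"
    using ge card_Un_le[of ?K "J n"] by linarith
  then have "?K \<union> J n \<in> indep M"
    using fin indep_imp_finite[OF K] by (intro indep_if_rank) auto
  then show ?case by (simp add: lessThan_Suc Un_commute)
qed

end

section \<open>Sets picked from a list\<close>

text \<open>The decision on an element sees the prefix ending with it. With the weights fixed,
  \<open>selected\<close> takes this form, and runs can be treated by induction on appended
  elements.\<close>

definition picks :: "('a list \<Rightarrow> bool) \<Rightarrow> 'a list \<Rightarrow> 'a set" where
  "picks Q \<sigma> = {\<sigma> ! i |i. i < length \<sigma> \<and> Q (take (Suc i) \<sigma>)}"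

lemma picks_Nil [simp]: "picks Q [] = {}"
  by (simp add: picks_def)

lemma picks_snoc [simp]:
  "picks Q (xs @ [x]) = (if Q (xs @ [x]) then insert x (picks Q xs) else picks Q xs)"
proof -
  have "{i. i < length (xs @ [x]) \<and> Q (take (Suc i) (xs @ [x]))} =
    {i. i < length xs \<and> Q (take (Suc i) xs)} \<union> (if Q (xs @ [x]) then {length xs} else {})"
    by (auto simp: less_Suc_eq)
  moreover have "picks Q ys = (!) ys ` {i. i < length ys \<and> Q (take (Suc i) ys)}" for ys
    by (auto simp: picks_def)
  ultimately show ?thesis
    by (auto simp: nth_append image_iff)
qed

lemma selected_eq_picks: "selected A w \<sigma> = picks (\<lambda>xs. A (map (\<lambda>x. (x, w x)) xs)) \<sigma>"
  by (simp add: selected_def picks_def)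

lemma picks_subset: "picks Q \<sigma> \<subseteq> set \<sigma>"
  by (auto simp: picks_def)

text \<open>The test refers to all earlier elements of \<open>I\<close>, not only to the kept ones.
  A rejected element of \<open>I\<close> is already spanned, so both versions have the same closure,
  and this one depends only on \<open>I\<close> and the order. The kept set is a basis of
  \<open>I \<inter> set \<sigma>\<close> after contracting \<open>P\<close>, even if
  \<open>I\<close> is dependent.\<close>

lemma greedy_rank:
  assumes M: "matroid M" and I: "I \<subseteq> ground M" and \<sigma>: "distinct \<sigma>"
    and K: "K = picks (\<lambda>xs. last xs \<in> I \<and> last xs \<notin> cl M (P \<union> (I \<inter> set (butlast xs)))) \<sigma>"
  shows "rank M (K \<union> P) = card K + rank M P"
    and "rank M (P \<union> (I \<inter> set \<sigma>)) = card K + rank M P"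
    and "K \<subseteq> I \<inter> set \<sigma>"
proof -
  define g where
    "g = picks (\<lambda>xs. last xs \<in> I \<and> last xs \<notin> cl M (P \<union> (I \<inter> set (butlast xs))))"
  have "rank M (g \<sigma> \<union> P) = card (g \<sigma>) + rank M P \<and>
    rank M (P \<union> (I \<inter> set \<sigma>)) = card (g \<sigma>) + rank M P \<and> g \<sigma> \<subseteq> I \<inter> set \<sigma>"
    using \<sigma>
  proof (induction \<sigma> rule: rev_induct)
    case Nil
    then show ?case by (simp add: g_def)
  next
    case (snoc x xs)
    let ?B = "P \<union> (I \<inter> set xs)"
    from snoc have IH: "rank M (g xs \<union> P) = card (g xs) + rank M P"
      "rank M ?B = card (g xs) + rank M P" "g xs \<subseteq> I \<inter> set xs" and x: "x \<notin> set xs" by auto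
    have g: "g (xs @ [x]) = (if x \<in> I \<and> x \<notin> cl M ?B then insert x (g xs) else g xs)"
      by (simp add: g_def)
    consider "x \<notin> I" | "x \<in> I" "x \<in> cl M ?B" | "x \<in> I" "x \<notin> cl M ?B" by blast
    then show ?case
    proof cases
      case 1
      then have "I \<inter> set (xs @ [x]) = I \<inter> set xs" by auto
      with 1 g IH show ?thesis by auto
    next
      case 2
      then have "P \<union> (I \<inter> set (xs @ [x])) = insert x ?B" by auto
      moreover from 2 have "rank M (insert x ?B) = rank M ?B" by (auto simp: cl_def)
      ultimately show ?thesis using 2 g IH by auto
    next
      case 3
      then have eq: "P \<union> (I \<inter> set (xs @ [x])) = insert x ?B" by auto
      have r: "rank M (insert x ?B) = Suc (rank M ?B)"
        using 3 I by (intro rank_insert_not_cl[OF M]) auto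
      \<comment> \<open>The rank increase at the larger set \<open>?B\<close> carries over to
        \<open>g xs \<union> P\<close>, so \<open>x\<close> is independent over the kept elements
        and \<open>P\<close>.\<close>
      have "rank M (insert x ?B) + rank M (g xs \<union> P) \<le> rank M (insert x (g xs \<union> P)) + rank M ?B"
        using IH(3) by (intro rank_submodular'[OF M]) auto
      moreover have "rank M (insert x (g xs \<union> P)) \<le> 1 + rank M (g xs \<union> P)"
        using rank_Un_le[OF M, of "{x}" "g xs \<union> P"] by simp
      ultimately have "rank M (insert x (g xs \<union> P)) = Suc (card (g xs) + rank M P)"
        using r IH by simp
      moreover have "finite (g xs)" "x \<notin> g xs" using IH(3) x finite_subset by auto
      ultimately show ?thesis using 3 g IH r eq by auto
    qed
  qed
  then show "rank M (K \<union> P) = card K + rank M P"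
    "rank M (P \<union> (I \<inter> set \<sigma>)) = card K + rank M P" "K \<subseteq> I \<inter> set \<sigma>"
    using K unfolding g_def by auto
qed

text \<open>The greedy rule keeps \<open>rank M (P \<union> I) - rank M P\<close> elements, so an
  independent \<open>I\<close> loses exactly its local connectivity to \<open>P\<close>.
  Monotonicity and the invariance of rank under closure bound this by the local connectivity of
  \<open>X\<close> and \<open>P\<close>.\<close>

lemma greedy_loss:
  assumes M: "matroid M" and I: "I \<in> indep M" "I \<subseteq> cl M X" and \<sigma>: "distinct \<sigma>" "I \<subseteq> set \<sigma>"
    and K: "K = picks (\<lambda>xs. last xs \<in> I \<and> last xs \<notin> cl M (P \<union> (I \<inter> set (butlast xs)))) \<sigma>"
    and k: "local_conn M X P \<le> int k"
  shows "card (I - K) \<le> k"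
proof -
  note g = greedy_rank[OF M indep_subset_ground[OF M I(1)] \<sigma>(1) K]
  have eq: "I \<inter> set \<sigma> = I" using \<sigma> by auto
  have "local_conn M I P \<le> local_conn M (X \<union> cl M X) P"
    using I by (intro local_conn_mono[OF M]) auto
  also have "\<dots> = local_conn M X P"
    using rank_Un_subset_cl[OF M, of "cl M X" X X] rank_Un_subset_cl[OF M, of "cl M X" X "X \<union> P"]
    by (simp add: local_conn_def Un_ac)
  finally have "int (card I) + int (rank M P) - int (card K + rank M P) \<le> int k"
    using k g(2) rank_indep[OF M I(1)] by (simp add: eq local_conn_def Un_commute)
  moreover have "card (I - K) = card I - card K"
    using g(3) indep_imp_finite[OF M I(1)] finite_subset by (intro card_Diff_subset) auto
  ultimately show ?thesis by linarith
qed

section \<open>Enumerating the vertices of a tree\<close>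

lemma rtrancl_imp_distinct_path:
  assumes "(u, v) \<in> R\<^sup>*"
  shows "\<exists>xs. xs \<noteq> [] \<and> hd xs = u \<and> last xs = v \<and> distinct xs \<and>
    (\<forall>i. Suc i < length xs \<longrightarrow> (xs ! i, xs ! Suc i) \<in> R)"
  using assms
proof (induction rule: rtrancl_induct)
  case base
  then show ?case by (intro exI[of _ "[u]"]) auto
next
  case (step y z)
  then obtain xs where xs: "xs \<noteq> []" "hd xs = u" "last xs = y" "distinct xs"
    "\<And>i. Suc i < length xs \<Longrightarrow> (xs ! i, xs ! Suc i) \<in> R" by blast
  show ?case
  proof (cases "z \<in> set xs")
    case True
    then obtain i where i: "i < length xs" "xs ! i = z" by (meson in_set_conv_nth)
    have "last (take (Suc i) xs) = z"
      using i by (simp add: take_Suc_conv_app_nth)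
    then show ?thesis
      using xs i by (intro exI[of _ "take (Suc i) xs"]) auto
  next
    case False
    have "(xs @ [z]) ! i = xs ! i" if "i < length xs" for i
      using that by (simp add: nth_append)
    then have "((xs @ [z]) ! i, (xs @ [z]) ! Suc i) \<in> R" if "Suc i < length (xs @ [z])" for i
    proof (cases "Suc i < length xs")
      case False
      then have "i = length xs - 1" using that by simp
      then show ?thesis
        using xs(1,3) step.hyps(2) by (simp add: nth_append last_conv_nth)
    qed (use xs(5)[of i] in \<open>simp add: nth_append\<close>)
    then show ?thesis
      using xs(1-4) False by (intro exI[of _ "xs @ [z]"]) auto
  qed
qed

section \<open>Components and the growth of a subtree\<close>

lemma component_refl: "u \<in> component F u"
  by (simp add: component_def)

lemma component_step: "v \<in> component F u \<Longrightarrow> {v, w} \<in> F \<Longrightarrow> w \<in> component F u"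
  unfolding component_def by (auto intro: rtrancl_into_rtrancl)

lemma component_trans: "v \<in> component F u \<Longrightarrow> w \<in> component F v \<Longrightarrow> w \<in> component F u"
  unfolding component_def by auto

lemma component_sym: "v \<in> component F u \<Longrightarrow> u \<in> component F v"
proof -
  have "sym {(x, y). {x, y} \<in> F}" by (auto simp: sym_def insert_commute)
  from symD[OF sym_rtrancl[OF this]]
  show "v \<in> component F u \<Longrightarrow> u \<in> component F v" by (simp add: component_def)
qed

lemma component_mono:
  assumes "F \<subseteq> G"
  shows "component F u \<subseteq> component G u"
proof -
  have "{(x, y). {x, y} \<in> F} \<subseteq> {(x, y). {x, y} \<in> G}" using assms by auto
  from rtrancl_mono[OF this] show ?thesis unfolding component_def by auto
qed

text \<open>A remaining path from \<open>u\<close> to \<open>v\<close> without repeated vertices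
  would be closed to a cycle by the removed edge. It has at least three vertices: one would force
  \<open>u = v\<close>, and two would make it use the removed edge.\<close>

lemma edge_removal_separates:
  assumes acyclic: "\<nexists>vs. is_cycle F vs" and e: "{u, v} \<in> F" "u \<noteq> v"
  shows "v \<notin> component (F - {{u, v}}) u"
proof
  assume "v \<in> component (F - {{u, v}}) u"
  then obtain xs where xs: "xs \<noteq> []" "hd xs = u" "last xs = v" "distinct xs"
    and E: "\<And>i. Suc i < length xs \<Longrightarrow> {xs ! i, xs ! Suc i} \<in> F - {{u, v}}"
    unfolding component_def by (auto dest!: rtrancl_imp_distinct_path)
  have hd: "xs ! 0 = u" and last: "xs ! (length xs - 1) = v"
    using xs by (auto simp: hd_conv_nth last_conv_nth)
  have "length xs \<noteq> 1" using hd last e by auto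
  moreover have "length xs \<noteq> 2" using hd last E[of 0] by auto
  ultimately have len: "3 \<le> length xs"
    using xs(1) length_0_conv[of xs] by linarith
  have "{xs ! i, xs ! (Suc i mod length xs)} \<in> F" if "i < length xs" for i
  proof (cases "Suc i < length xs")
    case False
    with that have "Suc i = length xs" "i = length xs - 1" by simp_all
    then have "{xs ! i, xs ! (Suc i mod length xs)} = {u, v}"
      using hd last by auto
    then show ?thesis using e by simp
  qed (use E[of i] in simp)
  then have "is_cycle F xs" using len xs(4) by (simp add: is_cycle_def)
  with acyclic show False by blast
qed

text \<open>Connectedness is demanded inside the graph induced by \<open>S\<close>: its paths avoid
  \<open>v\<close>, so deleting the edge to \<open>v\<close> leaves all of \<open>S\<close> on the
  side of \<open>u\<close>.\<close>

lemma tree_grow: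
  assumes tree: "is_tree V F" and S: "S \<subseteq> V" "S \<noteq> V" "S \<noteq> {}"
    and conn: "\<And>s t. s \<in> S \<Longrightarrow> t \<in> S \<Longrightarrow> t \<in> component {f \<in> F. f \<subseteq> S} s"
  shows "\<exists>u\<in>S. \<exists>v\<in>V - S. {u, v} \<in> F \<and> S \<subseteq> component (F - {{u, v}}) u \<and>
    v \<notin> component (F - {{u, v}}) u \<and>
    (\<forall>s\<in>insert v S. \<forall>t\<in>insert v S. t \<in> component {f \<in> F. f \<subseteq> insert v S} s)"
proof -
  have "\<exists>u\<in>S. \<exists>v\<in>V - S. {u, v} \<in> F"
  proof (rule ccontr)
    assume no: "\<not> ?thesis"
    obtain s where s: "s \<in> S" using S by blast
    have "t \<in> S" if "(s, t) \<in> {(x, y). {x, y} \<in> F}\<^sup>*" for t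
      using that
    proof (induction rule: rtrancl_induct)
      case (step y z)
      then have "{y, z} \<subseteq> V" using tree by (auto simp: is_tree_def simple_graph_def)
      with step no show ?case by auto
    qed (rule s)
    then have "component F s \<subseteq> S" by (auto simp: component_def)
    moreover have "component F s = V" using tree s S by (auto simp: is_tree_def)
    ultimately show False using S by auto
  qed
  then obtain u v where uv: "u \<in> S" "v \<in> V - S" "{u, v} \<in> F" by blast
  have "component {f \<in> F. f \<subseteq> S} u \<subseteq> component (F - {{u, v}}) u"
    using uv by (intro component_mono) auto
  then have "S \<subseteq> component (F - {{u, v}}) u" using conn uv by blast
  moreover have "v \<notin> component (F - {{u, v}}) u"
    using tree uv by (intro edge_removal_separates) (auto simp: is_tree_def)
  moreover have reach: "t \<in> component {f \<in> F. f \<subseteq> insert v S} u" if "t \<in> insert v S" for t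
  proof (cases "t = v")
    case True
    show ?thesis using uv component_step[OF component_refl, of u v] True by auto
  next
    case False
    have "component {f \<in> F. f \<subseteq> S} u \<subseteq> component {f \<in> F. f \<subseteq> insert v S} u"
      by (intro component_mono) auto
    then show ?thesis using False that conn uv by blast
  qed
  moreover have "t \<in> component {f \<in> F. f \<subseteq> insert v S} s"
    if "s \<in> insert v S" "t \<in> insert v S" for s t
    using component_trans[OF component_sym[OF reach[OF that(1)]] reach[OF that(2)]] .
  ultimately show ?thesis using uv by blast
qed

text \<open>The edge to the parent separates the new vertex from all earlier ones. This lets the
  thickness of a single edge bound the connectivity to the union of all earlier parts.\<close>

lemma tree_enumeration:
  assumes tree: "is_tree V F"
  obtains vs where "distinct vs" "set vs = V"
    and "\<And>i. 0 < i \<Longrightarrow> i < length vs \<Longrightarrow> \<exists>j<i. {vs ! j, vs ! i} \<in> F \<and>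
      set (take i vs) \<subseteq> component (F - {{vs ! j, vs ! i}}) (vs ! j) \<and>
      vs ! i \<notin> component (F - {{vs ! j, vs ! i}}) (vs ! j)"
proof -
  let ?P = "\<lambda>vs. \<forall>i. 0 < i \<and> i < length vs \<longrightarrow> (\<exists>j<i. {vs ! j, vs ! i} \<in> F \<and>
      set (take i vs) \<subseteq> component (F - {{vs ! j, vs ! i}}) (vs ! j) \<and>
      vs ! i \<notin> component (F - {{vs ! j, vs ! i}}) (vs ! j))"
  have fin: "finite V" using tree by (simp add: is_tree_def simple_graph_def)
  \<comment> \<open>The list has length \<open>Suc m\<close> because growth has to start from a
    nonempty set; connectedness of the induced graph is the invariant that feeds the next growth
    step.\<close>
  have ex: "\<exists>vs. distinct vs \<and> set vs \<subseteq> V \<and> length vs = Suc m \<and>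
    (\<forall>s\<in>set vs. \<forall>t\<in>set vs. t \<in> component {f \<in> F. f \<subseteq> set vs} s) \<and> ?P vs" if "m < card V" for m
    using that
  proof (induction m)
    case 0
    obtain r where "r \<in> V" using tree by (auto simp: is_tree_def)
    then show ?case by (intro exI[of _ "[r]"]) (auto simp: component_refl)
  next
    case (Suc m)
    then obtain vs where vs: "distinct vs" "set vs \<subseteq> V" "length vs = Suc m" "?P vs"
      "\<And>s t. s \<in> set vs \<Longrightarrow> t \<in> set vs \<Longrightarrow> t \<in> component {f \<in> F. f \<subseteq> set vs} s"
      by (auto dest: Suc_lessD)
    have "card (set vs) = Suc m" using vs distinct_card by metis
    then have "set vs \<noteq> V" "set vs \<noteq> {}" using Suc.prems by auto
    from tree_grow[OF tree vs(2) this vs(5)]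
    obtain u v where u: "u \<in> set vs" and v: "v \<in> V - set vs" and uv: "{u, v} \<in> F"
      "set vs \<subseteq> component (F - {{u, v}}) u" "v \<notin> component (F - {{u, v}}) u"
      "\<forall>s\<in>insert v (set vs). \<forall>t\<in>insert v (set vs). t \<in> component {f \<in> F. f \<subseteq> insert v (set vs)} s"
      by auto
    obtain j where j: "j < length vs" "vs ! j = u" using u by (meson in_set_conv_nth)
    have "?P (vs @ [v])"
    proof (intro allI impI)
      fix i assume i: "0 < i \<and> i < length (vs @ [v])"
      show "\<exists>j<i. {(vs @ [v]) ! j, (vs @ [v]) ! i} \<in> F \<and>
        set (take i (vs @ [v])) \<subseteq> component (F - {{(vs @ [v]) ! j, (vs @ [v]) ! i}}) ((vs @ [v]) ! j) \<and>
        (vs @ [v]) ! i \<notin> component (F - {{(vs @ [v]) ! j, (vs @ [v]) ! i}}) ((vs @ [v]) ! j)"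
      proof (cases "i < length vs")
        case True
        with i vs(4) obtain j' where "j' < i" "{vs ! j', vs ! i} \<in> F"
          "set (take i vs) \<subseteq> component (F - {{vs ! j', vs ! i}}) (vs ! j')"
          "vs ! i \<notin> component (F - {{vs ! j', vs ! i}}) (vs ! j')" by blast
        with True show ?thesis
          by (intro exI[of _ j']) (auto simp: nth_append)
      next
        case False
        then have "i = length vs" using i by simp
        then show ?thesis
          using j uv by (intro exI[of _ j]) (auto simp: nth_append)
      qed
    qed
    moreover have "distinct (vs @ [v])" "set (vs @ [v]) \<subseteq> V" "length (vs @ [v]) = Suc (Suc m)"
      using vs(1-3) v by auto
    moreover have "\<forall>s\<in>set (vs @ [v]). \<forall>t\<in>set (vs @ [v]). t \<in> component {f \<in> F. f \<subseteq> set (vs @ [v])} s"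
    proof -
      have "set (vs @ [v]) = insert v (set vs)" by simp
      then show ?thesis using uv(4) by (simp only:)
    qed
    ultimately show ?case by (intro exI[of _ "vs @ [v]"] conjI)
  qed
  have card: "card V - 1 < card V" "Suc (card V - 1) = card V"
    using fin tree by (auto simp: is_tree_def card_gt_0_iff)
  from ex[OF card(1)]
  obtain vs where vs: "distinct vs" "set vs \<subseteq> V" "length vs = Suc (card V - 1)" "?P vs"
    by blast
  have "set vs = V"
    using vs(1-3) card(2) fin distinct_card[OF vs(1)] by (intro card_subset_eq) auto
  show ?thesis
  proof (rule that[OF vs(1) \<open>set vs = V\<close>])
    fix i assume "0 < i" "i < length vs"
    then show "\<exists>j<i. {vs ! j, vs ! i} \<in> F \<and>
      set (take i vs) \<subseteq> component (F - {{vs ! j, vs ! i}}) (vs ! j) \<and>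
      vs ! i \<notin> component (F - {{vs ! j, vs ! i}}) (vs ! j)"
      using vs(4) by blast
  qed
qed

section \<open>The classical secretary problem\<close>

text \<open>Transfers uniformity from the global arrival order to the order that a piece sees.
  Relabelling the elements of \<open>C\<close> turns any order of \<open>C\<close> into any other
  and injects one fibre of the filter into the other, so all fibres are equally large.\<close>

lemma filter_permutations_of_set:
  assumes "finite E" "C \<subseteq> E"
  shows "map_pmf (filter (\<lambda>x. x \<in> C)) (pmf_of_set (permutations_of_set E)) =
    pmf_of_set (permutations_of_set C)"
proof -
  define fl where "fl = filter (\<lambda>x. x \<in> C)"
  define fib where "fib \<tau> = {\<sigma> \<in> permutations_of_set E. fl \<sigma> = \<tau>}" for \<tau>
  have finC: "finite C" using assms finite_subset by blast
  have fl: "fl \<sigma> \<in> permutations_of_set C" if "\<sigma> \<in> permutations_of_set E" for \<sigma>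
    using that assms unfolding fl_def permutations_of_set_def by auto
  have le: "card (fib \<tau>) \<le> card (fib \<tau>')"
    if \<tau>: "\<tau> \<in> permutations_of_set C" "\<tau>' \<in> permutations_of_set C" for \<tau> \<tau>'
  proof -
    have len: "length \<tau> = length \<tau>'"
      using \<tau> length_finite_permutations_of_set by metis
    \<comment> \<open>The relabelling sends the \<open>i\<close>-th entry of \<open>\<tau>\<close>
      to the \<open>i\<close>-th entry of \<open>\<tau>'\<close>. It preserves membership in
      \<open>C\<close>, hence commutes with the filter.\<close>
    define f where "f = (\<lambda>x. if x \<in> C then \<tau>' ! (THE i. i < length \<tau> \<and> \<tau> ! i = x) else x)"
    have f_nth: "f (\<tau> ! i) = \<tau>' ! i" if "i < length \<tau>" for i
    proof -
      have "(THE j. j < length \<tau> \<and> \<tau> ! j = \<tau> ! i) = i"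
        using that \<tau> by (intro the_equality) (auto simp: permutations_of_set_def nth_eq_iff_index_eq)
      then show ?thesis using that \<tau> by (auto simp: f_def permutations_of_set_def)
    qed
    have map_f: "map f \<tau> = \<tau>'" using len f_nth by (intro nth_equalityI) auto
    have "f ` C = C"
      using arg_cong[OF map_f, of set] \<tau> by (simp add: permutations_of_set_def)
    then have fC: "f permutes C"
      using finC by (intro bij_imp_permutes) (auto simp: f_def bij_betw_def intro: eq_card_imp_inj_on)
    then have fE: "f permutes E" using assms(2) permutes_subset by blast
    have "map f \<sigma> \<in> fib \<tau>'" if "\<sigma> \<in> fib \<tau>" for \<sigma>
    proof -
      have "(\<lambda>x. x \<in> C) \<circ> f = (\<lambda>x. x \<in> C)" using fC by (auto simp: permutes_in_image)
      then have "fl (map f \<sigma>) = map f (fl \<sigma>)" by (simp add: fl_def filter_map)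
      moreover have "map f \<sigma> \<in> permutations_of_set E"
        using that permutations_of_set_image_permutes[OF fE] by (force simp: fib_def)
      ultimately show ?thesis using that map_f by (auto simp: fib_def)
    qed
    moreover have "inj_on (map f) (fib \<tau>)"
      using permutes_inj[OF fE] by (simp add: inj_on_def)
    moreover have "finite (fib \<tau>')" by (simp add: fib_def)
    ultimately show ?thesis by (intro card_inj_on_le[of "map f"]) auto
  qed
  show ?thesis
  proof (rule pmf_eqI)
    fix \<tau>
    have ne: "permutations_of_set E \<noteq> {}" "permutations_of_set C \<noteq> {}"
      using assms finC by simp_all
    have pmf: "pmf (map_pmf fl (pmf_of_set (permutations_of_set E))) \<tau> =
      card (fib \<tau>) / card (permutations_of_set E)"
      using ne by (simp add: pmf_map measure_pmf_of_set fib_def vimage_def Int_def)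
    show "pmf (map_pmf (filter (\<lambda>x. x \<in> C)) (pmf_of_set (permutations_of_set E))) \<tau> =
      pmf (pmf_of_set (permutations_of_set C)) \<tau>"
    proof (cases "\<tau> \<in> permutations_of_set C")
      case True
      have "permutations_of_set E = (\<Union>\<tau>\<in>permutations_of_set C. fib \<tau>)"
        using fl by (auto simp: fib_def)
      then have "card (permutations_of_set E) = (\<Sum>\<tau>\<in>permutations_of_set C. card (fib \<tau>))"
        by (simp only:) (intro card_UN_disjoint, auto simp: fib_def)
      also have "\<dots> = (\<Sum>\<tau>'\<in>permutations_of_set C. card (fib \<tau>))"
        using le True by (intro sum.cong) (auto intro: le_antisym)
      finally have "card (permutations_of_set E) = card (permutations_of_set C) * card (fib \<tau>)"
        by simp
      moreover have "card (permutations_of_set E) > 0" using ne by (simp add: card_gt_0_iff)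
      ultimately show ?thesis
        using pmf ne True by (simp add: fl_def pmf_of_set)
    next
      case False
      then have "fib \<tau> = {}" using fl by (auto simp: fib_def)
      then show ?thesis using pmf ne False by (simp add: fl_def pmf_of_set)
    qed
  qed
qed

text \<open>The chord bound \<open>ln y \<le> (y - 1 / y) / 2\<close> is the trapezoidal rule for the convex
  function \<open>1 / t\<close>; the plain comparison of the harmonic sum with the logarithm
  is too weak for the constant \<open>1 / e\<close> at every finite \<open>n\<close>.\<close>

lemma ln_le_half_diff_inverse:
  fixes y :: real
  assumes "1 \<le> y"
  shows "ln y \<le> (y - 1 / y) / 2"
proof -
  have "(\<lambda>t::real. (t - 1 / t) / 2 - ln t) 1 \<le> (\<lambda>t. (t - 1 / t) / 2 - ln t) y"
    using assms
  proof (rule DERIV_nonneg_imp_nondecreasing)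
    fix t :: real assume t: "1 \<le> t" "t \<le> y"
    have "((\<lambda>t. (t - 1 / t) / 2 - ln t) has_real_derivative (1 - 1 / t)\<^sup>2 / 2) (at t)"
      using t by (auto intro!: derivative_eq_intros simp: field_simps power2_eq_square)
    then show "\<exists>d. ((\<lambda>t. (t - 1 / t) / 2 - ln t) has_real_derivative d) (at t) \<and> 0 \<le> d"
      by (intro exI[of _ "(1 - 1 / t)\<^sup>2 / 2"]) auto
  qed
  then show ?thesis by simp
qed

section \<open>Harmonic sums and the threshold of the classical rule\<close>

text \<open>The chord bound at \<open>y = (p + 1) / p\<close> telescopes to the logarithm. The term
  \<open>(1 / m - 1 / n) / 2\<close> is the surplus of the left Riemann sum of \<open>1 / t\<close>
  over the trapezoidal sum.\<close>

lemma harmonic_segment_ge: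
  assumes "0 < m" "m \<le> n"
  shows "ln (real n / m) + (1 / m - 1 / n) / 2 \<le> (\<Sum>p=m..<n. 1 / real p)"
  using assms(2)
proof (induction n rule: dec_induct)
  case base
  then show ?case using assms(1) by simp
next
  case (step n)
  have n: "0 < real n" using step assms by simp
  have "ln (real (Suc n) / n) \<le> (real (Suc n) / n - 1 / (real (Suc n) / n)) / 2"
    using n by (intro ln_le_half_diff_inverse) simp
  also have "\<dots> = (1 / n + 1 / real (Suc n)) / 2"
    using n by (simp add: field_simps)
  finally have "ln (real (Suc n) / n) \<le> (1 / n + 1 / real (Suc n)) / 2" .
  moreover have "ln (real (Suc n) / m) = ln (real n / m) + ln (real (Suc n) / n)"
    using n assms(1) by (simp add: ln_div)
  moreover have "(\<Sum>p=m..<Suc n. 1 / real p) = (\<Sum>p=m..<n. 1 / real p) + 1 / n"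
    using step by simp
  moreover have "L' + (c - b) / 2 \<le> S'" if "d \<le> (a + b) / 2" "L' = L + d" "S' = S + a"
    "L + (c - a) / 2 \<le> S" for L L' S S' a b c d :: real
    using that by (simp add: field_simps)
  ultimately show ?case using step.IH by blast
qed

text \<open>The threshold is \<open>n / e\<close> rounded to the nearest integer. Rounding costs at
  most \<open>3 / (4 * n^2)\<close>, since \<open>- x * ln x\<close> is flat at its maximum point
  \<open>1 / e\<close>; the trapezoidal surplus \<open>(1 - x) / (2 * n)\<close> pays for this once
  \<open>n \<ge> 4\<close>. For \<open>n = 2\<close> and \<open>n = 3\<close> the threshold
  \<open>1\<close> gives \<open>1 / 2\<close>.\<close>

lemma ex_secretary_threshold:
  assumes "2 \<le> n"
  shows "\<exists>m>0. m < n \<and> 1 / exp 1 \<le> real m / n * (\<Sum>p=m..<n. 1 / real p)"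
proof -
  have e2: "2 \<le> exp (1::real)" using exp_ge_add_one_self[of 1] by simp
  have e3: "exp (1::real) \<le> 3" by (rule exp_le)
  show ?thesis
  proof (cases "n \<le> 3")
    case True
    have "1 / exp 1 \<le> 1 / (2::real)" using e2 by (simp add: field_simps)
    moreover have "n = 2 \<or> n = 3" using True assms by auto
    ultimately show ?thesis
      by (intro exI[of _ 1]) (auto simp: numeral_eq_Suc)
  next
    case False
    define e where "e = exp (1::real)"
    have e: "2 \<le> e" "e \<le> 3" using e2 e3 by (auto simp: e_def)
    have n: "4 \<le> real n" using False by simp
    define m where "m = nat (round (n / e))"
    have "real n / 3 \<le> n / e" "n / e \<le> real n / 2" using e n by (intro frac_le; simp)+
    moreover have r: "\<bar>real_of_int (round (n / e)) - n / e\<bar> \<le> 1 / 2" by (rule of_int_round_abs_le)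
    ultimately have rb: "0 < real_of_int (round (n / e))" "real_of_int (round (n / e)) < n"
      using n by linarith+
    then have "real m = real_of_int (round (n / e))" by (simp add: m_def)
    with r rb have m: "\<bar>real m - n / e\<bar> \<le> 1 / 2" "0 < real m" "real m < n" by auto
    define x where "x = real m / n"
    have x: "0 < x" using m n by (simp add: x_def)
    have d: "\<bar>x - 1 / e\<bar> \<le> 1 / (2 * n)"
    proof -
      have "x - 1 / e = (real m - n / e) / n" using n by (simp add: x_def field_simps)
      then have "\<bar>x - 1 / e\<bar> = \<bar>real m - n / e\<bar> / n" by (simp add: abs_divide)
      also have "\<dots> \<le> (1 / 2) / n" using m n by (intro divide_right_mono) auto
      finally show ?thesis by simp
    qed
    \<comment> \<open>Tangent bound at the optimum, where \<open>e * x = 1\<close>; it makes the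
      loss quadratic in \<open>x - 1 / e\<close>.\<close>
    have "ln (e * x) \<le> e * x - 1" using x e by (intro ln_le_minus_one) auto
    moreover have "ln (e * x) = 1 + ln x" using x by (simp add: ln_mult e_def)
    ultimately have "2 - e * x \<le> - ln x" by simp
    then have "x * (2 - e * x) \<le> x * (- ln x)" using x by (intro mult_left_mono) auto
    moreover have "x * (2 - e * x) = 1 / e - e * (x - 1 / e)\<^sup>2"
      using e by (simp add: power2_eq_square field_simps)
    moreover have "e * (x - 1 / e)\<^sup>2 \<le> 3 * (1 / (2 * n))\<^sup>2"
      using d e by (intro mult_mono) (auto simp: abs_le_square_iff[symmetric])
    ultimately have 1: "1 / e - 3 * (1 / (2 * n))\<^sup>2 \<le> x * (- ln x)" by linarith
    have "1 / e \<le> 1 / 2" using e by (simp add: field_simps)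
    then have "1 - x \<ge> 1 / 2 - 1 / (2 * n)" using d by linarith
    moreover have "1 / 2 \<ge> 2 / real n" using n by (simp add: field_simps)
    ultimately have "1 - x \<ge> 3 / (2 * n)" by (simp add: field_simps)
    then have "(1 - x) / (2 * n) \<ge> 3 / (2 * n) / (2 * n)" by (intro divide_right_mono) auto
    then have 2: "(1 - x) / (2 * n) \<ge> 3 * (1 / (2 * n))\<^sup>2" by (simp add: power2_eq_square)
    have "ln (real n / m) = - ln x" using m n by (simp add: x_def ln_div)
    then have "- ln x + (1 / m - 1 / n) / 2 \<le> (\<Sum>p=m..<n. 1 / real p)"
      using harmonic_segment_ge[of m n] m by simp
    then have "x * (- ln x + (1 / m - 1 / n) / 2) \<le> x * (\<Sum>p=m..<n. 1 / real p)"
      using x by (intro mult_left_mono) auto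
    moreover have "x * (- ln x + (1 / m - 1 / n) / 2) = x * (- ln x) + (1 - x) / (2 * n)"
      using m n by (simp add: x_def field_simps)
    ultimately have "1 / e \<le> x * (\<Sum>p=m..<n. 1 / real p)" using 1 2 by linarith
    then show ?thesis using m by (intro exI[of _ m]) (auto simp: x_def e_def)
  qed
qed

text \<open>The last condition excludes that an earlier element has already been accepted: all
  elements since the first \<open>m\<close> were beaten by one of those.\<close>

definition accepts :: "('a \<Rightarrow> 'a \<Rightarrow> bool) \<Rightarrow> nat \<Rightarrow> 'a list \<Rightarrow> bool" where
  "accepts lt m xs \<longleftrightarrow> m < length xs \<and> (\<forall>y\<in>set (butlast xs). lt y (last xs)) \<and>
     (\<forall>y\<in>set (drop m (butlast xs)). \<exists>z\<in>set (take m xs). lt y z)"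

section \<open>Accepted positions and the number of successful orders\<close>

lemma accepts_take_iff:
  assumes "p < length \<sigma>"
  shows "accepts lt m (take (Suc p) \<sigma>) \<longleftrightarrow> m \<le> p \<and> (\<forall>l<p. lt (\<sigma> ! l) (\<sigma> ! p)) \<and>
    (\<forall>l. m \<le> l \<and> l < p \<longrightarrow> (\<exists>j<m. lt (\<sigma> ! l) (\<sigma> ! j)))"
proof -
  have [simp]: "butlast (take (Suc p) \<sigma>) = take p \<sigma>" "last (take (Suc p) \<sigma>) = \<sigma> ! p"
    using assms by (auto simp: take_Suc_conv_app_nth)
  have len: "m < length (take (Suc p) \<sigma>) \<longleftrightarrow> m \<le> p"
    using assms by auto
  have "set (take m (take (Suc p) \<sigma>)) = (!) \<sigma> ` {0..<m}" if "m \<le> p"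
    using that assms by (subst nth_image) (auto simp: min_def)
  then have skipped: "(\<exists>z\<in>set (take m (take (Suc p) \<sigma>)). R z) \<longleftrightarrow> (\<exists>j<m. R (\<sigma> ! j))"
    if "m \<le> p" for R
    using that by auto
  have "set (take p \<sigma>) = (!) \<sigma> ` {0..<p}"
    using assms by (subst nth_image) auto
  then have earlier: "(\<forall>y\<in>set (take p \<sigma>). R y) \<longleftrightarrow> (\<forall>l<p. R (\<sigma> ! l))" for R
    by auto
  have "set (drop m (take p \<sigma>)) = (!) \<sigma> ` {m..<p}"
  proof -
    have "set (drop m (take p \<sigma>)) = (\<lambda>i. \<sigma> ! (m + i)) ` {0..<p - m}"
      using assms nth_image[of "p - m" "drop m (take p \<sigma>)"]
      by (simp add: min_def)
    also have "\<dots> = (!) \<sigma> ` {m..<p}"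
    proof (cases "m \<le> p")
      case True
      then have "{m..<p} = (+) m ` {0..<p - m}" by simp
      then show ?thesis by (simp only: image_image)
    qed simp
    finally show ?thesis .
  qed
  then have between: "(\<forall>y\<in>set (drop m (take p \<sigma>)). R y) \<longleftrightarrow>
      (\<forall>l. m \<le> l \<and> l < p \<longrightarrow> R (\<sigma> ! l))" for R
    by auto
  show ?thesis
    by (cases "m \<le> p") (simp_all add: accepts_def len skipped earlier between
        del: take_take length_take drop_take)
qed

text \<open>If positions \<open>p < q\<close> were both accepted, acceptance at \<open>q\<close>
  would provide one of the first \<open>m\<close> elements beating the element at \<open>p\<close>,
  while acceptance at \<open>p\<close> says that the latter beats all its predecessors.\<close>

lemma accepts_unique:
  assumes "transp lt" "irreflp lt"
    and "x \<in> picks (accepts lt m) \<sigma>" "y \<in> picks (accepts lt m) \<sigma>"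
  shows "x = y"
proof -
  have False if "p < q" "q < length \<sigma>" "accepts lt m (take (Suc p) \<sigma>)"
    "accepts lt m (take (Suc q) \<sigma>)" for p q
  proof -
    from that have "m \<le> p" "\<forall>l<p. lt (\<sigma> ! l) (\<sigma> ! p)" and
      "\<forall>l. m \<le> l \<and> l < q \<longrightarrow> (\<exists>j<m. lt (\<sigma> ! l) (\<sigma> ! j))"
      by (auto simp: accepts_take_iff)
    with that(1) obtain j where "j < m" "lt (\<sigma> ! p) (\<sigma> ! j)" "lt (\<sigma> ! j) (\<sigma> ! p)" by force
    with assms(1,2) show False by (meson irreflpD transpD)
  qed
  moreover obtain p q where "x = \<sigma> ! p" "p < length \<sigma>" "accepts lt m (take (Suc p) \<sigma>)"
    "y = \<sigma> ! q" "q < length \<sigma>" "accepts lt m (take (Suc q) \<sigma>)"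
    using assms(3,4) unfolding picks_def by blast
  ultimately show ?thesis by (metis nat_neq_iff)
qed

text \<open>Exchanging two positions is an involution on the orders. This symmetry yields that the
  best element, and the best of an initial segment, are equally likely at each position.\<close>

lemma card_permutations_swap:
  assumes "a < card X" "b < card X"
  shows "card {\<sigma> \<in> permutations_of_set X. R (permute_list (Transposition.transpose a b) \<sigma>)} =
    card {\<sigma> \<in> permutations_of_set X. R \<sigma>}"
proof -
  let ?f = "permute_list (Transposition.transpose a b)"
  have p: "Transposition.transpose a b permutes {..<card X}"
    using assms by (intro permutes_swap_id) auto
  have len: "length \<sigma> = card X" if "\<sigma> \<in> permutations_of_set X" for \<sigma>
    using that length_finite_permutations_of_set by auto
  have mem: "?f \<sigma> \<in> permutations_of_set X" if "\<sigma> \<in> permutations_of_set X" for \<sigma>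
    using that p len[OF that] by (auto simp: permutations_of_set_def)
  have inv: "?f (?f \<sigma>) = \<sigma>" if "\<sigma> \<in> permutations_of_set X" for \<sigma>
    using p len[OF that] by (simp flip: permute_list_compose)
  show ?thesis
    by (rule bij_betw_same_card[of ?f], rule bij_betw_byWitness[of _ ?f]) (use mem inv in auto)
qed

text \<open>\<open>B p\<close> is a \<open>1 / n\<close> share of all orders. \<open>A p j\<close>
  also places the best of the first \<open>p\<close> elements at position \<open>j\<close>, which is
  a \<open>1 / p\<close> share of \<open>B p\<close>. The rule takes \<open>b\<close> whenever
  \<open>m \<le> p\<close> and \<open>j < m\<close>, and these disjoint cases add up to the stated
  sum.\<close>

lemma secretary_success_count:
  assumes X: "finite X" and lt: "transp lt" "irreflp lt" "totalp_on X lt"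
    and b: "b \<in> X" "\<And>y. y \<in> X \<Longrightarrow> y \<noteq> b \<Longrightarrow> lt y b" and m: "0 < m" "m < card X"
  shows "fact (card X) * (real m / card X * (\<Sum>p=m..<card X. 1 / real p)) \<le>
    card {\<sigma> \<in> permutations_of_set X. b \<in> picks (accepts lt m) \<sigma>}"
proof -
  define n where "n = card X"
  define B where "B p = {\<sigma> \<in> permutations_of_set X. \<sigma> ! p = b}" for p
  define A where "A p j = {\<sigma> \<in> permutations_of_set X. \<sigma> ! p = b \<and>
    (\<forall>l<p. l \<noteq> j \<longrightarrow> lt (\<sigma> ! l) (\<sigma> ! j))}" for p j
  have fin: "finite (B p)" "finite (A p j)" for p j by (auto simp: A_def B_def)
  have len: "length \<sigma> = n" and dist: "distinct \<sigma>" and set: "set \<sigma> = X"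
    if "\<sigma> \<in> permutations_of_set X" for \<sigma>
    using that length_finite_permutations_of_set by (auto simp: n_def permutations_of_set_def)
  have n: "0 < n" using m by (simp add: n_def)
  have cB: "card (B p) = card (B q)" if "p < n" "q < n" for p q
  proof -
    have "permute_list (Transposition.transpose p q) \<sigma> ! p = \<sigma> ! q"
      if "\<sigma> \<in> permutations_of_set X" for \<sigma>
      using len[OF that] \<open>p < n\<close> \<open>q < n\<close>
      by (subst permute_list_nth) (auto intro: permutes_swap_id)
    then have "B q = {\<sigma> \<in> permutations_of_set X.
        permute_list (Transposition.transpose p q) \<sigma> ! p = b}"
      by (auto simp: B_def)
    then show ?thesis
      using card_permutations_swap[of p X q "\<lambda>\<sigma>. \<sigma> ! p = b"] that by (simp add: B_def n_def)
  qed
  have cA: "card (A p j) = card (A p i)" if "j < p" "i < p" "p < n" for p i j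
  proof -
    let ?t = "Transposition.transpose j i"
    have "\<sigma> \<in> A p i \<longleftrightarrow> permute_list ?t \<sigma> ! p = b \<and>
        (\<forall>l<p. l \<noteq> j \<longrightarrow> lt (permute_list ?t \<sigma> ! l) (permute_list ?t \<sigma> ! j))"
      if \<sigma>: "\<sigma> \<in> permutations_of_set X" for \<sigma>
    proof -
      have nth: "permute_list ?t \<sigma> ! l = \<sigma> ! ?t l" if "l < n" for l
        using len[OF \<sigma>] that \<open>j < p\<close> \<open>i < p\<close> \<open>p < n\<close>
        by (subst permute_list_nth) (auto intro: permutes_swap_id)
      have "(\<forall>l<p. l \<noteq> i \<longrightarrow> lt (\<sigma> ! l) (\<sigma> ! i)) \<longleftrightarrow>
        (\<forall>l<p. l \<noteq> j \<longrightarrow> lt (\<sigma> ! ?t l) (\<sigma> ! i))"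
      proof (intro iffI allI impI)
        fix l assume *: "\<forall>l<p. l \<noteq> i \<longrightarrow> lt (\<sigma> ! l) (\<sigma> ! i)" "l < p" "l \<noteq> j"
        have "?t l < p" "?t l \<noteq> i"
          using *(2,3) \<open>j < p\<close> \<open>i < p\<close> by (auto simp: Transposition.transpose_def)
        then show "lt (\<sigma> ! ?t l) (\<sigma> ! i)" using * by blast
      next
        fix l assume *: "\<forall>l<p. l \<noteq> j \<longrightarrow> lt (\<sigma> ! ?t l) (\<sigma> ! i)" "l < p" "l \<noteq> i"
        have "?t l < p" "?t l \<noteq> j" "?t (?t l) = l"
          using *(2,3) \<open>j < p\<close> \<open>i < p\<close> by (auto simp: Transposition.transpose_def)
        then show "lt (\<sigma> ! l) (\<sigma> ! i)" using *(1) by metis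
      qed
      moreover have "?t p = p" "?t j = i" using \<open>j < p\<close> \<open>i < p\<close> by auto
      ultimately show ?thesis
        using \<sigma> nth \<open>j < p\<close> \<open>i < p\<close> \<open>p < n\<close> by (auto simp: A_def)
    qed
    then have "A p i = {\<sigma> \<in> permutations_of_set X. permute_list ?t \<sigma> ! p = b \<and>
        (\<forall>l<p. l \<noteq> j \<longrightarrow> lt (permute_list ?t \<sigma> ! l) (permute_list ?t \<sigma> ! j))}"
      by (auto simp: A_def)
    then show ?thesis
      using card_permutations_swap[of j X i
        "\<lambda>\<sigma>. \<sigma> ! p = b \<and> (\<forall>l<p. l \<noteq> j \<longrightarrow> lt (\<sigma> ! l) (\<sigma> ! j))"] that
      by (simp add: A_def n_def)
  qed
  have UB: "permutations_of_set X = (\<Union>p<n. B p)"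
  proof -
    have "\<exists>p<n. \<sigma> ! p = b" if "\<sigma> \<in> permutations_of_set X" for \<sigma>
      using len[OF that] set[OF that] b(1) by (metis in_set_conv_nth)
    then show ?thesis by (auto simp: B_def)
  qed
  have disjB: "B p \<inter> B q = {}" if "p < n" "q < n" "p \<noteq> q" for p q
  proof -
    have False if "\<sigma> \<in> B p" "\<sigma> \<in> B q" for \<sigma>
    proof -
      from that have "\<sigma> \<in> permutations_of_set X" "\<sigma> ! p = \<sigma> ! q" by (auto simp: B_def)
      then show False
        using len dist \<open>p < n\<close> \<open>q < n\<close> \<open>p \<noteq> q\<close> nth_eq_iff_index_eq by metis
    qed
    then show ?thesis by auto
  qed
  have card_B: "real (card (B p)) = fact n / n" if "p < n" for p
  proof -
    have "fact n = card (permutations_of_set X)" using X by (simp add: n_def)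
    also have "\<dots> = card (\<Union>q<n. B q)" by (simp only: UB)
    also have "\<dots> = (\<Sum>q<n. card (B q))"
      using fin disjB by (intro card_UN_disjoint) auto
    also have "\<dots> = (\<Sum>q<n. card (B p))" using that by (intro sum.cong refl cB) auto
    finally have "fact n = n * card (B p)" by simp
    then have "real (fact n) = n * card (B p)" by (simp only: of_nat_mult)
    then show ?thesis using n by (simp add: field_simps)
  qed
  have disjA: "A p i \<inter> A p j = {}" if "i < p" "j < p" "i \<noteq> j" for p i j
  proof -
    have False if "\<sigma> \<in> A p i" "\<sigma> \<in> A p j" for \<sigma>
    proof -
      have "lt (\<sigma> ! j) (\<sigma> ! i)" "lt (\<sigma> ! i) (\<sigma> ! j)"
        using that \<open>i < p\<close> \<open>j < p\<close> \<open>i \<noteq> j\<close> by (auto simp: A_def)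
      then show False using lt(1,2) by (meson irreflpD transpD)
    qed
    then show ?thesis by auto
  qed
  have card_A: "real (card (A p j)) = fact n / n / p" if "j < p" "p < n" for p j
  proof -
    have "\<exists>i<p. \<forall>l<p. l \<noteq> i \<longrightarrow> lt (\<sigma> ! l) (\<sigma> ! i)" if \<sigma>: "\<sigma> \<in> permutations_of_set X" for \<sigma>
    proof -
      have "(\<exists>i<q. \<forall>l<q. l \<noteq> i \<longrightarrow> lt (\<sigma> ! l) (\<sigma> ! i))" if "0 < q" "q \<le> n" for q
        using that
      proof (induction q rule: nat_induct_non_zero)
        case (Suc q)
        then obtain i where i: "i < q" "\<And>l. l < q \<Longrightarrow> l \<noteq> i \<Longrightarrow> lt (\<sigma> ! l) (\<sigma> ! i)" by auto
        have "\<sigma> ! i \<in> X" "\<sigma> ! q \<in> X" "\<sigma> ! i \<noteq> \<sigma> ! q"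
          using i Suc.prems len[OF \<sigma>] set[OF \<sigma>] dist[OF \<sigma>] by (auto simp: nth_eq_iff_index_eq)
        then consider "lt (\<sigma> ! i) (\<sigma> ! q)" | "lt (\<sigma> ! q) (\<sigma> ! i)"
          using lt(3) by (auto simp: totalp_on_def)
        then show ?case
        proof cases
          case 1
          then have "lt (\<sigma> ! l) (\<sigma> ! q)" if "l < q" for l
            using i that lt(1) by (metis transpD)
          then show ?thesis by (intro exI[of _ q]) (auto simp: less_Suc_eq)
        next
          case 2
          then show ?thesis using i by (intro exI[of _ i]) (auto simp: less_Suc_eq)
        qed
      qed auto
      then show ?thesis using that \<open>j < p\<close> \<open>p < n\<close> by auto
    qed
    then have "B p = (\<Union>i<p. A p i)" by (auto simp: A_def B_def)
    then have "card (B p) = (\<Sum>i<p. card (A p i))"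
      using fin disjA by (simp only:) (intro card_UN_disjoint, auto)
    also have "\<dots> = (\<Sum>i<p. card (A p j))" using that by (intro sum.cong refl cA) auto
    finally have "card (B p) = p * card (A p j)" by simp
    then have "real (card (B p)) = p * card (A p j)" by (simp only: of_nat_mult)
    then show ?thesis using card_B[of p] that by (simp add: field_simps)
  qed
  have sub: "(\<Union>p\<in>{m..<n}. \<Union>j<m. A p j) \<subseteq> {\<sigma> \<in> permutations_of_set X. b \<in> picks (accepts lt m) \<sigma>}"
  proof
    fix \<sigma> assume "\<sigma> \<in> (\<Union>p\<in>{m..<n}. \<Union>j<m. A p j)"
    then obtain p j where p: "m \<le> p" "p < n" "j < m" "\<sigma> \<in> A p j" by auto
    then have \<sigma>: "\<sigma> \<in> permutations_of_set X" "\<sigma> ! p = b"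
      "\<forall>l<p. l \<noteq> j \<longrightarrow> lt (\<sigma> ! l) (\<sigma> ! j)" by (auto simp: A_def)
    have "lt (\<sigma> ! l) b" if "l < p" for l
    proof (rule b(2))
      show "\<sigma> ! l \<in> X" using that p \<sigma> len set by (metis less_trans nth_mem)
      show "\<sigma> ! l \<noteq> b"
        using that p \<sigma> len dist nth_eq_iff_index_eq by (metis less_trans nat_neq_iff)
    qed
    then have "accepts lt m (take (Suc p) \<sigma>)"
      using p \<sigma> len[OF \<sigma>(1)] by (subst accepts_take_iff) auto
    then have "b \<in> picks (accepts lt m) \<sigma>"
      using p \<sigma> len[OF \<sigma>(1)] by (auto simp: picks_def)
    then show "\<sigma> \<in> {\<sigma> \<in> permutations_of_set X. b \<in> picks (accepts lt m) \<sigma>}" using \<sigma> by simp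
  qed
  have "card (\<Union>p\<in>{m..<n}. \<Union>j<m. A p j) = (\<Sum>p=m..<n. \<Sum>j<m. card (A p j))"
  proof (subst card_UN_disjoint)
    show "\<forall>p\<in>{m..<n}. \<forall>q\<in>{m..<n}. p \<noteq> q \<longrightarrow> (\<Union>j<m. A p j) \<inter> (\<Union>j<m. A q j) = {}"
    proof (intro ballI impI)
      fix p q assume "p \<in> {m..<n}" "q \<in> {m..<n}" "p \<noteq> q"
      then have "B p \<inter> B q = {}" using disjB by auto
      then show "(\<Union>j<m. A p j) \<inter> (\<Union>j<m. A q j) = {}" by (auto simp: A_def B_def)
    qed
    show "(\<Sum>p=m..<n. card (\<Union>j<m. A p j)) = (\<Sum>p=m..<n. \<Sum>j<m. card (A p j))"
      using fin disjA by (intro sum.cong refl card_UN_disjoint) auto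
  qed (use fin in auto)
  then have "real (card (\<Union>p\<in>{m..<n}. \<Union>j<m. A p j)) = (\<Sum>p=m..<n. \<Sum>j<m. fact n / n / p)"
    using card_A by simp
  also have "\<dots> = fact n * (real m / n * (\<Sum>p=m..<n. 1 / real p))"
    by (simp add: sum_distrib_left mult_ac)
  finally show ?thesis
    using card_mono[OF _ sub] by (simp add: n_def)
qed

text \<open>The order of quantifiers matters: \<open>m\<close> is fixed from \<open>X\<close> alone,
  before the unknown weights determine the comparison \<open>lt\<close> and the best element
  \<open>b\<close>.\<close>

lemma ex_secretary_rule:
  assumes X: "finite X"
  shows "\<exists>m. \<forall>lt b. transp lt \<longrightarrow> irreflp lt \<longrightarrow> totalp_on X lt \<longrightarrow> b \<in> X \<longrightarrow>
    (\<forall>y\<in>X. y \<noteq> b \<longrightarrow> lt y b) \<longrightarrow>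
    1 / exp 1 \<le> measure_pmf.prob (pmf_of_set (permutations_of_set X))
      {\<sigma>. b \<in> picks (accepts lt m) \<sigma>}"
proof -
  have prob: "measure_pmf.prob (pmf_of_set (permutations_of_set X)) {\<sigma>. Q \<sigma>} =
    card {\<sigma> \<in> permutations_of_set X. Q \<sigma>} / fact (card X)" for Q
    using X by (simp add: measure_pmf_of_set Int_def)
  consider "card X = 0" | "card X = 1" | "2 \<le> card X" by linarith
  then show ?thesis
  proof cases
    case 1
    then show ?thesis using X by auto
  next
    case 2
    then obtain x where x: "X = {x}" by (auto simp: card_1_singleton_iff)
    have e: "1 \<le> exp (1::real)" using exp_ge_add_one_self[of 1] by simp
    \<comment> \<open>A singleton allows no observation phase, so its threshold is
      \<open>0\<close>.\<close>
    have "{\<sigma> \<in> permutations_of_set X. x \<in> picks (accepts lt 0) \<sigma>} = {[x]}" for lt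
      by (auto simp: x picks_def accepts_def)
    then show ?thesis unfolding prob using x e by (intro exI[of _ 0]) (auto simp: field_simps)
  next
    case 3
    then obtain m where m: "0 < m" "m < card X"
      "1 / exp 1 \<le> real m / card X * (\<Sum>p=m..<card X. 1 / real p)"
      using ex_secretary_threshold by blast
    show ?thesis
    proof (intro exI[of _ m] allI impI)
      fix lt b
      assume "transp lt" "irreflp lt" "totalp_on X lt" "b \<in> X" "\<forall>y\<in>X. y \<noteq> b \<longrightarrow> lt y b"
      then have "fact (card X) * (real m / card X * (\<Sum>p=m..<card X. 1 / real p)) \<le>
        card {\<sigma> \<in> permutations_of_set X. b \<in> picks (accepts lt m) \<sigma>}"
        using X m by (intro secretary_success_count) auto
      then have "real m / card X * (\<Sum>p=m..<card X. 1 / real p) \<le>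
        card {\<sigma> \<in> permutations_of_set X. b \<in> picks (accepts lt m) \<sigma>} / fact (card X)"
        by (simp add: pos_le_divide_eq mult.commute)
      with m(3) show "1 / exp 1 \<le> measure_pmf.prob (pmf_of_set (permutations_of_set X))
        {\<sigma>. b \<in> picks (accepts lt m) \<sigma>}"
        unfolding prob by linarith
    qed
  qed
qed

section \<open>Online algorithms\<close>

text \<open>An algorithm given by its decisions in terms of the weight function and the list of
  revealed elements; legitimate when only the weights of revealed elements matter.\<close>

definition online_of :: "(('a \<Rightarrow> real) \<Rightarrow> 'a list \<Rightarrow> bool) \<Rightarrow> 'a online_alg" where
  "online_of Q h = Q (\<lambda>x. case map_of h x of None \<Rightarrow> 0 | Some r \<Rightarrow> r) (map fst h)"

lemma selected_online_of:
  assumes "\<And>w w' xs. (\<And>x. x \<in> set xs \<Longrightarrow> w x = w' x) \<Longrightarrow> Q w xs = Q w' xs"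
  shows "selected (online_of Q) w \<sigma> = picks (Q w) \<sigma>"
proof -
  have "online_of Q (map (\<lambda>x. (x, w x)) xs) = Q w xs" for xs
  proof -
    have "map fst (map (\<lambda>x. (x, w x)) xs) = xs" by (simp add: comp_def)
    then show ?thesis
      unfolding online_of_def
      by (simp only:) (rule assms, simp add: map_of_map_restrict)
  qed
  then show ?thesis by (simp add: selected_eq_picks)
qed

text \<open>Later arrivals do not change earlier decisions; distinctness keeps an element of
  \<open>xs\<close> from being picked at a second arrival.\<close>

lemma picks_append: "distinct (xs @ ys) \<Longrightarrow> picks Q (xs @ ys) \<inter> set xs = picks Q xs"
proof (induction ys rule: rev_induct)
  case Nil
  then show ?case using picks_subset[of Q xs] by auto
next
  case (snoc y ys)
  have "picks Q ((xs @ ys) @ [y]) \<inter> set xs = picks Q (xs @ ys) \<inter> set xs"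
    using snoc.prems by (auto simp del: append_assoc)
  then show ?case using snoc by simp
qed

text \<open>Simulates a run on a subset within the full order. The guard
  \<open>last xs \<in> C\<close> keeps an arrival outside \<open>C\<close> from repeating the
  decision on the preceding filtered element.\<close>

lemma picks_filter:
  "picks (\<lambda>xs. last xs \<in> C \<and> Q (filter (\<lambda>x. x \<in> C) xs)) \<sigma> = picks Q (filter (\<lambda>x. x \<in> C) \<sigma>)"
  by (induction \<sigma> rule: rev_induct) auto

lemma picks_cong_on:
  assumes "\<And>t. t < length \<sigma> \<Longrightarrow> \<sigma> ! t \<in> Y \<Longrightarrow> Q (take (Suc t) \<sigma>) = R (take (Suc t) \<sigma>)"
  shows "picks Q \<sigma> \<inter> Y = picks R \<sigma> \<inter> Y"
  using assms by (auto simp: picks_def)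

lemma last_take_Suc: "t < length \<sigma> \<Longrightarrow> last (take (Suc t) \<sigma>) = \<sigma> ! t"
  by (simp add: take_Suc_conv_app_nth)

lemma butlast_take_Suc: "t < length \<sigma> \<Longrightarrow> butlast (take (Suc t) \<sigma>) = take t \<sigma>"
  by (simp add: take_Suc_conv_app_nth)

lemma picks_subset_if:
  assumes "\<And>xs. Q xs \<Longrightarrow> last xs \<in> Y"
  shows "picks Q \<sigma> \<subseteq> Y"
  unfolding picks_def using assms last_take_Suc by fastforce

lemma selected_subset: "selected A w \<sigma> \<subseteq> set \<sigma>"
  by (simp add: selected_eq_picks picks_subset)

lemma selected_cong:
  assumes "\<And>x. x \<in> set \<sigma> \<Longrightarrow> w x = w' x"
  shows "selected A w \<sigma> = selected A w' \<sigma>"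
proof -
  have "map (\<lambda>x. (x, w x)) (take i \<sigma>) = map (\<lambda>x. (x, w' x)) (take i \<sigma>)" for i
    using assms set_take_subset[of i \<sigma>] by (intro map_cong) auto
  then show ?thesis unfolding selected_def by (simp only:)
qed

section \<open>Measurability and randomized algorithms\<close>

lemma measurable_selected:
  assumes "\<And>h. (\<lambda>\<omega>. B \<omega> h) \<in> measurable P (count_space UNIV)"
  shows "(\<lambda>\<omega>. selected (B \<omega>) w \<sigma>) \<in> measurable P (count_space UNIV)"
proof (induction \<sigma> rule: rev_induct)
  case Nil
  then show ?case by (simp add: selected_eq_picks)
next
  case (snoc x \<sigma>)
  have "Measurable.pred P (\<lambda>\<omega>. B \<omega> (map (\<lambda>x. (x, w x)) (\<sigma> @ [x])))"
    using assms by blast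
  moreover have "(\<lambda>\<omega>. insert x (selected (B \<omega>) w \<sigma>)) \<in> measurable P (count_space UNIV)"
    by (rule measurable_compose[OF snoc]) simp
  ultimately show ?case
    using snoc by (auto simp: selected_eq_picks pred_def intro!: measurable_If)
qed

lemma measurable_sum_selected:
  assumes "\<And>h. (\<lambda>\<omega>. B \<omega> h) \<in> measurable P (count_space UNIV)" "distinct \<sigma>"
  shows "(\<lambda>\<omega>. \<Sum>x\<in>selected (B \<omega>) w \<sigma>. w x) \<in> borel_measurable P"
  by (rule measurable_compose[OF measurable_selected[OF assms(1)]]) simp

lemma integrable_sum_selected:
  fixes w :: "'a \<Rightarrow> real"
  assumes P: "prob_space P" and B: "\<And>h. (\<lambda>\<omega>. B \<omega> h) \<in> measurable P (count_space UNIV)"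
    and \<sigma>: "distinct \<sigma>"
  shows "integrable P (\<lambda>\<omega>. \<Sum>x\<in>selected (B \<omega>) w \<sigma>. w x)"
proof -
  interpret prob_space P by fact
  have "\<bar>\<Sum>x\<in>selected A w \<sigma>. w x\<bar> \<le> (\<Sum>x\<in>set \<sigma>. \<bar>w x\<bar>)" for A
  proof -
    have "\<bar>\<Sum>x\<in>selected A w \<sigma>. w x\<bar> \<le> (\<Sum>x\<in>selected A w \<sigma>. \<bar>w x\<bar>)" by (rule sum_abs)
    also have "\<dots> \<le> (\<Sum>x\<in>set \<sigma>. \<bar>w x\<bar>)" by (intro sum_mono2 selected_subset) auto
    finally show ?thesis .
  qed
  then show ?thesis
    using measurable_sum_selected[OF B \<sigma>, where w = w]
    by (intro integrable_const_bound[of _ "\<Sum>x\<in>set \<sigma>. \<bar>w x\<bar>"]) auto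
qed

text \<open>Pushes \<open>P\<close> forward along \<open>G\<close> to the feasible algorithms,
  equipped with the sigma-algebra generated by the single decisions; measurability of
  \<open>G\<close> then amounts to measurability of each decision.\<close>

lemma ex_secretary_alg_of_random:
  fixes G :: "'b \<Rightarrow> 'a online_alg"
  assumes fin: "finite (ground M)" and P: "prob_space P"
    and feas: "\<And>\<omega>. \<omega> \<in> space P \<Longrightarrow> feasible M (G \<omega>)"
    and G: "\<And>h. (\<lambda>\<omega>. G \<omega> h) \<in> measurable P (count_space UNIV)"
  shows "\<exists>D. secretary_alg M D \<and> (\<forall>w. alg_value M D w =
    measure_pmf.expectation (pmf_of_set (permutations_of_set (ground M)))
      (\<lambda>\<sigma>. \<integral>\<omega>. (\<Sum>x\<in>selected (G \<omega>) w \<sigma>. w x) \<partial>P))"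
proof -
  define Q :: "'a online_alg measure" where
    "Q = restrict_space (PiM UNIV (\<lambda>_. count_space UNIV)) {A. feasible M A}"
  have eval: "(\<lambda>A. A h) \<in> measurable Q (count_space UNIV)" for h
    unfolding Q_def by (intro measurable_restrict_space1 measurable_component_singleton) simp
  have GQ: "G \<in> measurable P Q"
    unfolding Q_def using feas G
    by (intro measurable_restrict_space2 measurable_PiM_single') auto
  have space: "space (distr P Q G) = {A. feasible M A}"
    by (simp add: Q_def space_restrict_space space_PiM)
  have "secretary_alg M (distr P Q G)"
    unfolding secretary_alg_def
  proof (intro conjI)
    show "prob_space (distr P Q G)" by (rule prob_space.prob_space_distr[OF P GQ])
    show "\<forall>A\<in>space (distr P Q G). feasible M A" using space by simp
    show "\<forall>h. (\<lambda>A. A h) \<in> measurable (distr P Q G) (count_space UNIV)" using eval by simp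
  qed
  moreover have "alg_value M (distr P Q G) w =
    measure_pmf.expectation (pmf_of_set (permutations_of_set (ground M)))
      (\<lambda>\<sigma>. \<integral>\<omega>. (\<Sum>x\<in>selected (G \<omega>) w \<sigma>. w x) \<partial>P)" for w
  proof -
    have "(\<integral>A. (\<Sum>x\<in>selected A w \<sigma>. w x) \<partial>distr P Q G) =
      (\<integral>\<omega>. (\<Sum>x\<in>selected (G \<omega>) w \<sigma>. w x) \<partial>P)" if "\<sigma> \<in> permutations_of_set (ground M)" for \<sigma>
      using that GQ eval
      by (intro integral_distr measurable_sum_selected) (auto dest: permutations_of_setD)
    then show ?thesis
      unfolding alg_value_def using fin by (simp add: integral_pmf_of_set)
  qed
  ultimately show ?thesis by blast
qed

text \<open>A coin independent of \<open>P\<close> chooses \<open>S\<close> with probability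
  \<open>p\<close>, and integrating over the product space separates the two branches.\<close>

lemma ex_mixed_alg:
  fixes G :: "'b \<Rightarrow> 'a online_alg" and p :: real
  assumes fin: "finite (ground M)" and P: "prob_space P"
    and feas: "\<And>\<omega>. \<omega> \<in> space P \<Longrightarrow> feasible M (G \<omega>)"
    and G: "\<And>h. (\<lambda>\<omega>. G \<omega> h) \<in> measurable P (count_space UNIV)"
    and S: "feasible M S" and p: "0 \<le> p" "p \<le> 1"
  shows "\<exists>D. secretary_alg M D \<and> (\<forall>w. alg_value M D w =
    p * measure_pmf.expectation (pmf_of_set (permutations_of_set (ground M)))
      (\<lambda>\<sigma>. \<Sum>x\<in>selected S w \<sigma>. w x) +
    (1 - p) * measure_pmf.expectation (pmf_of_set (permutations_of_set (ground M)))
      (\<lambda>\<sigma>. \<integral>\<omega>. (\<Sum>x\<in>selected (G \<omega>) w \<sigma>. w x) \<partial>P))"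
proof -
  interpret P: prob_space P by fact
  interpret PP: pair_prob_space "measure_pmf (bernoulli_pmf p)" P by standard
  define PP where "PP = measure_pmf (bernoulli_pmf p) \<Otimes>\<^sub>M P"
  define H where "H = (\<lambda>(b, \<omega>). if b then S else G \<omega>)"
  have H: "(\<lambda>\<omega>. H \<omega> h) \<in> measurable PP (count_space UNIV)" for h
  proof -
    have fst: "Measurable.pred PP fst"
      unfolding PP_def by (rule measurable_compose[OF measurable_fst]) simp
    have "Measurable.pred PP (\<lambda>\<omega>. G (snd \<omega>) h)"
      unfolding PP_def by (rule measurable_compose[OF measurable_snd G])
    then have "Measurable.pred PP (\<lambda>\<omega>. if fst \<omega> then S h else G (snd \<omega>) h)"
      using fst by (intro measurable_If) (auto simp: pred_def)
    moreover have "(\<lambda>\<omega>. H \<omega> h) = (\<lambda>\<omega>. if fst \<omega> then S h else G (snd \<omega>) h)"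
      by (intro ext) (simp add: H_def split_beta)
    ultimately show ?thesis by simp
  qed
  have PP: "prob_space PP" unfolding PP_def by unfold_locales
  have "feasible M (H \<omega>)" if "\<omega> \<in> space PP" for \<omega>
    using that feas S by (auto simp: H_def PP_def space_pair_measure split: prod.splits)
  from ex_secretary_alg_of_random[OF fin PP this H]
  obtain D where D: "secretary_alg M D" "\<And>w. alg_value M D w =
    measure_pmf.expectation (pmf_of_set (permutations_of_set (ground M)))
      (\<lambda>\<sigma>. \<integral>\<omega>. (\<Sum>x\<in>selected (H \<omega>) w \<sigma>. w x) \<partial>PP)" by blast
  have int: "(\<integral>\<omega>. (\<Sum>x\<in>selected (H \<omega>) w \<sigma>. w x) \<partial>PP) =
    p * (\<Sum>x\<in>selected S w \<sigma>. w x) + (1 - p) * (\<integral>\<omega>. (\<Sum>x\<in>selected (G \<omega>) w \<sigma>. w x) \<partial>P)"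
    if "\<sigma> \<in> permutations_of_set (ground M)" for w \<sigma>
  proof -
    have "distinct \<sigma>" using that by (auto dest: permutations_of_setD)
    then have "integrable PP (\<lambda>\<omega>. \<Sum>x\<in>selected (H \<omega>) w \<sigma>. w x)"
      using PP H by (intro integrable_sum_selected)
    then have "(\<integral>\<omega>. (\<Sum>x\<in>selected (H \<omega>) w \<sigma>. w x) \<partial>PP) =
      (\<integral>b. \<integral>\<omega>. (\<Sum>x\<in>selected (H (b, \<omega>)) w \<sigma>. w x) \<partial>P \<partial>measure_pmf (bernoulli_pmf p))"
      unfolding PP_def by (rule PP.integral_fst'[symmetric])
    also have "\<dots> = (\<Sum>x\<in>selected S w \<sigma>. w x) * p +
        (\<integral>\<omega>. (\<Sum>x\<in>selected (G \<omega>) w \<sigma>. w x) \<partial>P) * (1 - p)"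
      using p by (simp add: H_def P.prob_space)
    finally show ?thesis by (simp add: mult.commute)
  qed
  have "alg_value M D w =
    p * measure_pmf.expectation (pmf_of_set (permutations_of_set (ground M)))
      (\<lambda>\<sigma>. \<Sum>x\<in>selected S w \<sigma>. w x) +
    (1 - p) * measure_pmf.expectation (pmf_of_set (permutations_of_set (ground M)))
      (\<lambda>\<sigma>. \<integral>\<omega>. (\<Sum>x\<in>selected (G \<omega>) w \<sigma>. w x) \<partial>P)" for w
    unfolding D(2) using fin int
    by (simp add: integral_pmf_of_set sum.distrib add_divide_distrib flip: sum_distrib_left)
  with D(1) show ?thesis by blast
qed

section \<open>Combining algorithms for the pieces of a matroid\<close>

text \<open>The classical rule is analysed for a strict total order, so ties in weight are broken by
  a numbering \<open>f\<close> fixed in advance.\<close>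

definition beats :: "('a \<Rightarrow> nat) \<Rightarrow> ('a \<Rightarrow> real) \<Rightarrow> 'a \<Rightarrow> 'a \<Rightarrow> bool" where
  "beats f w x y \<longleftrightarrow> w x < w y \<or> w x = w y \<and> f x < f y"

lemma beats_order: "transp (beats f w)" "irreflp (beats f w)"
  "inj_on f S \<Longrightarrow> totalp_on S (beats f w)"
  by (auto simp: beats_def transp_def irreflp_def totalp_on_def inj_on_def)
    (metis linorder_neqE_nat)

lemma ex_beats_max:
  assumes "finite S" "S \<noteq> {}" "inj_on f S"
  shows "\<exists>b\<in>S. \<forall>y\<in>S. y \<noteq> b \<longrightarrow> beats f w y b"
  using assms
proof (induction S rule: finite_ne_induct)
  case (insert x S)
  then obtain b where b: "b \<in> S" "\<forall>y\<in>S. y \<noteq> b \<longrightarrow> beats f w y b" by auto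
  have "beats f w x b \<or> beats f w b x"
    using beats_order(3)[OF insert.prems, of w] b(1) insert.hyps(3)
    by (auto simp: totalp_on_def)
  then show ?case
  proof
    assume "beats f w b x"
    then have "\<forall>y\<in>insert x S. y \<noteq> x \<longrightarrow> beats f w y x"
      using b beats_order(1)[of f w] by (metis insertE transpD)
    then show ?thesis by blast
  qed (use b in blast)
qed simp

lemma accepts_cong:
  assumes "\<And>x y. x \<in> set xs \<Longrightarrow> y \<in> set xs \<Longrightarrow> lt x y = lt' x y"
  shows "accepts lt m xs = accepts lt' m xs"
proof (cases "m < length xs")
  case True
  then have "last xs \<in> set xs" by (intro last_in_set) auto
  moreover have "set (butlast xs) \<subseteq> set xs" by (auto dest: in_set_butlastD)
  moreover have "set (drop m (butlast xs)) \<subseteq> set xs"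
    using set_drop_subset[of m "butlast xs"] by (auto dest: in_set_butlastD)
  moreover have "set (take m xs) \<subseteq> set xs" by (rule set_take_subset)
  ultimately show ?thesis
    unfolding accepts_def using assms by (smt (verit, ccfv_threshold) subsetD)
qed (simp add: accepts_def)

text \<open>What remains of the tree: an order of the parts in which \<open>P i\<close> is the part
  of the parent, or empty at the first vertex. \<open>conn_P\<close> is the consequence of fullness,
  and \<open>conn_le\<close> comes from the thickness bound.\<close>

locale piece_sequence =
  fixes M :: "'a matroid_system" and X P :: "nat \<Rightarrow> 'a set" and n k :: nat
  assumes matroid: "matroid M"
    and X_ground: "\<And>i. i < n \<Longrightarrow> X i \<subseteq> ground M"
    and cover: "ground M \<subseteq> (\<Union>i<n. X i)"
    and P_cases: "\<And>i. i < n \<Longrightarrow> P i = {} \<or> (\<exists>j<i. P i = X j)"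
    and conn_P: "\<And>i. i < n \<Longrightarrow> local_conn M (X i) (\<Union>j<i. X j) = local_conn M (X i) (P i)"
    and conn_le: "\<And>i. i < n \<Longrightarrow> local_conn M (X i) (P i) \<le> int k"
begin

definition C :: "nat \<Rightarrow> 'a set" where "C i = cl M (X i)"

text \<open>Elements of \<open>X i\<close> spanned by an earlier part are reassigned to the earliest
  part spanning them, so that no element of \<open>Y i\<close> becomes a loop after contracting \<open>P i\<close>.\<close>

definition Y :: "nat \<Rightarrow> 'a set" where "Y i = C i - cl M {} - (\<Union>j<i. C j)"

lemma finite_ground: "finite (ground M)"
  by (rule finite_ground[OF matroid])

lemma C_ground: "C i \<subseteq> ground M"
  by (simp add: C_def cl_subset_ground[OF matroid])

lemma Y_subset_C: "Y i \<subseteq> C i"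
  by (auto simp: Y_def)

lemma Y_ground: "Y i \<subseteq> ground M"
  using Y_subset_C C_ground by blast

lemma finite_Y: "finite (Y i)"
  using Y_ground finite_ground finite_subset by blast

lemma Y_disjoint: "x \<in> Y i \<Longrightarrow> x \<in> Y j \<Longrightarrow> i = j"
  by (rule ccontr) (auto simp: Y_def neq_iff)

lemma Y_not_cl: "i < n \<Longrightarrow> x \<in> Y i \<Longrightarrow> x \<notin> cl M (P i)"
  using P_cases[of i] by (auto simp: Y_def C_def)

text \<open>Elements of an independent set are not loops, and the least index whose closure contains
  such an element is the index of its piece.\<close>

lemma indep_subset_Y:
  assumes "I \<in> indep M"
  shows "I \<subseteq> (\<Union>i<n. Y i)"
proof
  fix x assume x: "x \<in> I"
  then have g: "x \<in> ground M" using assms indep_subset_ground[OF matroid] by blast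
  then obtain j where j: "j < n" "x \<in> X j" using cover by auto
  then have "x \<in> C j" using subset_cl[OF matroid X_ground[OF j(1)]] by (auto simp: C_def)
  define i where "i = (LEAST i. x \<in> C i)"
  have i: "x \<in> C i" "i \<le> j" "\<And>l. l < i \<Longrightarrow> x \<notin> C l"
    unfolding i_def using \<open>x \<in> C j\<close> by (auto intro: LeastI Least_le dest: not_less_Least)
  have "rank M {x} = 1"
    using rank_indep[OF matroid indep_mono[OF matroid assms, of "{x}"]] x by simp
  then have "x \<notin> cl M {}" by (simp add: cl_def rank_empty[OF matroid])
  with i j(1) show "x \<in> (\<Union>i<n. Y i)" by (auto simp: Y_def intro!: bexI[of _ i])
qed

text \<open>Independence only has to be checked over the parent part; \<open>conn_P\<close> upgrades
  it to independence over all earlier parts, which is what joining the pieces requires.\<close>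

lemma indep_union:
  assumes "\<And>i. i < n \<Longrightarrow> J i \<subseteq> Y i"
    and "\<And>i. i < n \<Longrightarrow> rank M (J i \<union> P i) = card (J i) + rank M (P i)"
  shows "(\<Union>i<n. J i) \<in> indep M"
proof (rule indep_UN_over[OF matroid])
  fix i assume i: "i < n"
  show J: "J i \<subseteq> cl M (X i)" using assms(1)[OF i] Y_subset_C by (auto simp: C_def)
  have "P i \<subseteq> (\<Union>j<i. X j)" using P_cases[OF i] by auto
  then show "rank M (J i \<union> (\<Union>j<i. X j)) = card (J i) + rank M (\<Union>j<i. X j)"
    using rank_over_superset[OF matroid _ conn_P[OF i] J assms(2)[OF i]] by blast
qed

lemma sum_Y:
  fixes w :: "'a \<Rightarrow> real"
  assumes "S \<subseteq> (\<Union>i<n. Y i)"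
  shows "(\<Sum>x\<in>S. w x) = (\<Sum>i<n. \<Sum>x\<in>S \<inter> Y i. w x)"
proof -
  have "S = (\<Union>i<n. S \<inter> Y i)" using assms by auto
  moreover have "(\<Sum>x\<in>(\<Union>i<n. S \<inter> Y i). w x) = (\<Sum>i<n. \<Sum>x\<in>S \<inter> Y i. w x)"
    using finite_Y Y_disjoint by (intro sum.UNION_disjoint) auto
  ultimately show ?thesis by simp
qed

definition wt :: "('a \<Rightarrow> real) \<Rightarrow> nat \<Rightarrow> 'a \<Rightarrow> real" where
  "wt w i x = (if x \<in> Y i then w x else 0)"

text \<open>The inserted \<open>0\<close> is the value of an empty piece.\<close>

definition best :: "('a \<Rightarrow> real) \<Rightarrow> nat \<Rightarrow> real" where
  "best w i = Max (insert 0 (w ` Y i))"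

lemma best_ge: "x \<in> Y i \<Longrightarrow> w x \<le> best w i" "0 \<le> best w i"
  using finite_Y by (auto simp: best_def)

lemma ground_restriction: "ground (restriction M (C i)) = C i"
  using C_ground by (auto simp: restriction_def)

lemma weighting_wt: "weighting M w \<Longrightarrow> weighting (restriction M (C i)) (wt w i)"
  using Y_ground by (auto simp: weighting_def wt_def)

text \<open>The pieces cut an optimal set into traces, each a candidate in its own restriction, and
  \<open>wt\<close> agrees with \<open>w\<close> there.\<close>

lemma opt_le_sum_opt:
  "opt M w \<le> (\<Sum>i<n. opt (restriction M (C i)) (wt w i))"
proof -
  have "opt M w \<in> (\<lambda>I. \<Sum>x\<in>I. w x) ` indep M"
    unfolding opt_def using finite_indep[OF matroid] empty_indep[OF matroid]
    by (intro Max_in) auto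
  then obtain I where I: "I \<in> indep M" "opt M w = (\<Sum>x\<in>I. w x)" by auto
  have "(\<Sum>x\<in>I \<inter> Y i. w x) \<le> opt (restriction M (C i)) (wt w i)" for i
  proof -
    have "I \<inter> Y i \<in> indep (restriction M (C i))"
      using Y_subset_C indep_mono[OF matroid I(1)] by (auto simp: restriction_def)
    moreover have "finite (indep (restriction M (C i)))"
      using finite_indep[OF matroid] by (simp add: restriction_def)
    moreover have "(\<Sum>x\<in>I \<inter> Y i. w x) = (\<Sum>x\<in>I \<inter> Y i. wt w i x)"
      by (intro sum.cong) (auto simp: wt_def)
    ultimately show ?thesis unfolding opt_def by (intro Max_ge) auto
  qed
  then show ?thesis
    unfolding I(2) sum_Y[OF indep_subset_Y[OF I(1)]] by (intro sum_mono)
qed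

subsection \<open>Running the given algorithms on all pieces\<close>

text \<open>The given algorithm is run on all of \<open>C i\<close>, because its guarantee concerns
  a uniform order of that set; its selections outside \<open>Y i\<close> have weight
  \<open>0\<close> and are dropped.\<close>

definition inner :: "(nat \<Rightarrow> 'a online_alg) \<Rightarrow> ('a \<Rightarrow> real) \<Rightarrow> nat \<Rightarrow> 'a list \<Rightarrow> 'a set" where
  "inner A w i xs = selected (A i) (wt w i) (filter (\<lambda>x. x \<in> C i) xs) \<inter> Y i"

definition main_rule :: "(nat \<Rightarrow> 'a online_alg) \<Rightarrow> ('a \<Rightarrow> real) \<Rightarrow> 'a list \<Rightarrow> bool" where
  "main_rule A w xs \<longleftrightarrow> (\<exists>i<n. last xs \<in> inner A w i xs \<and>
     last xs \<notin> cl M (P i \<union> inner A w i (butlast xs)))"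

lemma inner_cong:
  assumes "\<And>x. x \<in> set xs \<Longrightarrow> w x = w' x"
  shows "inner A w i xs = inner A w' i xs"
  unfolding inner_def using assms by (subst selected_cong[of _ "wt w i" "wt w' i"]) (auto simp: wt_def)

lemma selected_main:
  "selected (online_of (main_rule A)) w \<sigma> = picks (main_rule A w) \<sigma>"
proof (rule selected_online_of)
  fix w w' :: "'a \<Rightarrow> real" and xs
  assume *: "\<And>x. x \<in> set xs \<Longrightarrow> w x = w' x"
  then have "inner A w i xs = inner A w' i xs" "inner A w i (butlast xs) = inner A w' i (butlast xs)" for i
    by (auto intro!: inner_cong dest: in_set_butlastD simp del: inner_def)
  then show "main_rule A w xs = main_rule A w' xs" by (simp add: main_rule_def)
qed

text \<open>The inner selection on a prefix is the trace of the final one, so the online test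
  becomes a greedy rule for a set that is fixed once the order is known.\<close>

lemma inner_take:
  assumes "distinct \<sigma>"
  shows "inner A w i (take t \<sigma>) = inner A w i \<sigma> \<inter> set (take t \<sigma>)"
proof -
  let ?f = "filter (\<lambda>x. x \<in> C i)"
  have append: "selected (A i) (wt w i) xs = selected (A i) (wt w i) (xs @ ys) \<inter> set xs"
    if "distinct (xs @ ys)" for xs ys
    unfolding selected_eq_picks using picks_append[OF that] by simp
  have f: "?f \<sigma> = ?f (take t \<sigma>) @ ?f (drop t \<sigma>)"
    by (simp flip: filter_append)
  have "selected (A i) (wt w i) (?f (take t \<sigma>)) =
      selected (A i) (wt w i) (?f \<sigma>) \<inter> set (?f (take t \<sigma>))"
    unfolding f using assms by (intro append) (simp flip: f)
  then show ?thesis using Y_subset_C by (auto simp: inner_def)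
qed

lemma picks_main_Y:
  assumes i: "i < n" and \<sigma>: "distinct \<sigma>" and I: "I = inner A w i \<sigma>"
  shows "picks (main_rule A w) \<sigma> \<inter> Y i =
    picks (\<lambda>xs. last xs \<in> I \<and> last xs \<notin> cl M (P i \<union> (I \<inter> set (butlast xs)))) \<sigma>"
proof -
  let ?R = "\<lambda>xs. last xs \<in> I \<and> last xs \<notin> cl M (P i \<union> (I \<inter> set (butlast xs)))"
  have "picks (main_rule A w) \<sigma> \<inter> Y i = picks ?R \<sigma> \<inter> Y i"
  proof (rule picks_cong_on)
    fix t assume t: "t < length \<sigma>" "\<sigma> ! t \<in> Y i"
    have "main_rule A w (take (Suc t) \<sigma>) \<longleftrightarrow> \<sigma> ! t \<in> inner A w i (take (Suc t) \<sigma>) \<and>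
        \<sigma> ! t \<notin> cl M (P i \<union> inner A w i (take t \<sigma>))"
      unfolding main_rule_def last_take_Suc[OF t(1)] butlast_take_Suc[OF t(1)]
      using t(2) Y_disjoint i by (auto simp: inner_def)
    moreover have "\<sigma> ! t \<in> set (take (Suc t) \<sigma>)"
      using t(1) by (simp add: take_Suc_conv_app_nth)
    ultimately show "main_rule A w (take (Suc t) \<sigma>) = ?R (take (Suc t) \<sigma>)"
      unfolding last_take_Suc[OF t(1)] butlast_take_Suc[OF t(1)] inner_take[OF \<sigma>] I by auto
  qed
  moreover have "picks ?R \<sigma> \<subseteq> Y i"
    by (rule picks_subset_if) (auto simp: I inner_def)
  ultimately show ?thesis by auto
qed

lemma picks_main_subset: "picks (main_rule A w) \<sigma> \<subseteq> (\<Union>i<n. Y i)"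
  by (rule picks_subset_if) (auto simp: main_rule_def inner_def)

lemma filter_C:
  assumes "\<sigma> \<in> permutations_of_set (ground M)"
  shows "filter (\<lambda>x. x \<in> C i) \<sigma> \<in> permutations_of_set (ground (restriction M (C i)))"
  using assms C_ground unfolding ground_restriction by (auto simp: permutations_of_set_def)

lemma inner_indep:
  assumes "feasible (restriction M (C i)) (A i)" "weighting M w"
    and "\<sigma> \<in> permutations_of_set (ground M)"
  shows "inner A w i \<sigma> \<in> indep M"
proof -
  have "selected (A i) (wt w i) (filter (\<lambda>x. x \<in> C i) \<sigma>) \<in> indep (restriction M (C i))"
    using assms filter_C weighting_wt by (auto simp: feasible_def)
  then show ?thesis
    by (auto simp: restriction_def inner_def intro: indep_mono[OF matroid])
qed

lemma feasible_main:
  assumes "\<And>i. i < n \<Longrightarrow> feasible (restriction M (C i)) (A i)"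
  shows "feasible M (online_of (main_rule A))"
  unfolding feasible_def selected_main
proof (intro allI impI)
  fix w \<sigma> assume w: "weighting M w" and \<sigma>: "\<sigma> \<in> permutations_of_set (ground M)"
  have dist: "distinct \<sigma>" using \<sigma> by (rule permutations_of_setD)
  let ?K = "\<lambda>i. picks (main_rule A w) \<sigma> \<inter> Y i"
  have "(\<Union>i<n. ?K i) \<in> indep M"
  proof (rule indep_union)
    fix i assume i: "i < n"
    have "inner A w i \<sigma> \<subseteq> ground M"
      using Y_ground by (auto simp: inner_def)
    from greedy_rank(1)[OF matroid this dist picks_main_Y[OF i dist refl]]
    show "rank M (?K i \<union> P i) = card (?K i) + rank M (P i)" .
  qed auto
  moreover have "(\<Union>i<n. ?K i) = picks (main_rule A w) \<sigma>"
    using picks_main_subset[of A w \<sigma>] by auto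
  ultimately show "picks (main_rule A w) \<sigma> \<in> indep M" by simp
qed

text \<open>The bound holds for each single order and each choice of deterministic algorithms: at
  most \<open>k\<close> inner selections are rejected per piece, each of weight at most
  \<open>best w i\<close>. Expectations then follow by linearity.\<close>

lemma main_value:
  assumes A: "\<And>i. i < n \<Longrightarrow> feasible (restriction M (C i)) (A i)" and w: "weighting M w"
    and \<sigma>: "\<sigma> \<in> permutations_of_set (ground M)"
  shows "(\<Sum>i<n. (\<Sum>x\<in>selected (A i) (wt w i) (filter (\<lambda>x. x \<in> C i) \<sigma>). wt w i x) - k * best w i)
    \<le> (\<Sum>x\<in>selected (online_of (main_rule A)) w \<sigma>. w x)"
  unfolding selected_main sum_Y[OF picks_main_subset]
proof (rule sum_mono)
  fix i assume "i \<in> {..<n}"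
  then have i: "i < n" by simp
  have dist: "distinct \<sigma>" and set: "set \<sigma> = ground M" using \<sigma> by (auto dest: permutations_of_setD)
  let ?S = "selected (A i) (wt w i) (filter (\<lambda>x. x \<in> C i) \<sigma>)"
  define I where "I = inner A w i \<sigma>"
  define K where "K = picks (main_rule A w) \<sigma> \<inter> Y i"
  note K_eq = K_def[unfolded picks_main_Y[OF i dist I_def]]
  have I: "I \<in> indep M" unfolding I_def by (rule inner_indep[OF _ w \<sigma>]) (rule A[OF i])
  have I_Y: "I \<subseteq> Y i" by (auto simp: I_def inner_def)
  have fin: "finite I" using I indep_imp_finite[OF matroid] by blast
  have "card (I - K) \<le> k"
    using I I_Y Y_subset_C[of i] Y_ground[of i] set dist
    by (intro greedy_loss[OF matroid _ _ _ _ K_eq conn_le[OF i]]) (auto simp: C_def)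
  have K_I: "K \<subseteq> I"
    using greedy_rank(3)[OF matroid indep_subset_ground[OF matroid I] dist K_eq] by auto
  have "(\<Sum>x\<in>?S. wt w i x) = (\<Sum>x\<in>I. w x)"
    unfolding I_def inner_def
    by (rule sum.mono_neutral_cong_right) (auto simp: wt_def intro: finite_subset[OF selected_subset])
  also have "\<dots> = (\<Sum>x\<in>I - K. w x) + (\<Sum>x\<in>K. w x)"
    using sum.subset_diff[OF K_I fin] .
  also have "(\<Sum>x\<in>I - K. w x) \<le> card (I - K) * best w i"
    using I_Y best_ge by (intro sum_bounded_above) auto
  also have "\<dots> \<le> k * best w i"
    using \<open>card (I - K) \<le> k\<close> best_ge by (intro mult_right_mono) auto
  finally show "(\<Sum>x\<in>?S. wt w i x) - k * best w i \<le> (\<Sum>x\<in>picks (main_rule A w) \<sigma> \<inter> Y i. w x)"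
    by (simp add: K_def)
qed

lemma measurable_main:
  assumes "\<And>i h. i < n \<Longrightarrow> (\<lambda>\<omega>. B \<omega> i h) \<in> measurable Q (count_space UNIV)"
  shows "(\<lambda>\<omega>. online_of (main_rule (B \<omega>)) h) \<in> measurable Q (count_space UNIV)"
proof -
  have sel: "(\<lambda>\<omega>. selected (B \<omega> i) w' ys) \<in> measurable Q (count_space UNIV)" if "i < n" for i w' ys
    using assms[OF that] by (intro measurable_selected)
  have picked: "Measurable.pred Q (\<lambda>\<omega>. x \<in> inner (B \<omega>) w i xs)"
    and spanned: "Measurable.pred Q (\<lambda>\<omega>. x \<notin> cl M (P i \<union> inner (B \<omega>) w i xs))"
    if "i < n" for i w x xs
    unfolding inner_def by (rule measurable_compose[OF sel[OF that]], simp)+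
  have "Measurable.pred Q (\<lambda>\<omega>. \<exists>i\<in>{..<n}. x \<in> inner (B \<omega>) w i xs \<and>
      x \<notin> cl M (P i \<union> inner (B \<omega>) w i ys))" for w x xs ys
  proof (rule pred_intros_finite(4)[OF finite_lessThan])
    fix i assume "i \<in> {..<n}"
    then have i: "i < n" by simp
    show "Measurable.pred Q (\<lambda>\<omega>. x \<in> inner (B \<omega>) w i xs \<and>
        x \<notin> cl M (P i \<union> inner (B \<omega>) w i ys))"
      by (rule pred_intros_logic(3)[OF picked[OF i] spanned[OF i]])
  qed
  then show ?thesis
    unfolding online_of_def main_rule_def by (simp only: Bex_def lessThan_iff)
qed

subsection \<open>Running the classical rule on all pieces\<close>

definition secretary_rule :: "('a \<Rightarrow> nat) \<Rightarrow> (nat \<Rightarrow> nat) \<Rightarrow> ('a \<Rightarrow> real) \<Rightarrow> 'a list \<Rightarrow> bool" where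
  "secretary_rule f m w xs \<longleftrightarrow> (\<exists>i<n. last xs \<in> Y i \<and>
     accepts (beats f w) (m i) (filter (\<lambda>x. x \<in> Y i) xs))"

lemma selected_secretary:
  "selected (online_of (secretary_rule f m)) w \<sigma> = picks (secretary_rule f m w) \<sigma>"
proof (rule selected_online_of)
  fix w w' :: "'a \<Rightarrow> real" and xs
  assume "\<And>x. x \<in> set xs \<Longrightarrow> w x = w' x"
  then have "accepts (beats f w) (m i) (filter (\<lambda>x. x \<in> Y i) xs) =
      accepts (beats f w') (m i) (filter (\<lambda>x. x \<in> Y i) xs)" for i
    by (intro accepts_cong) (auto simp: beats_def)
  then show "secretary_rule f m w xs = secretary_rule f m w' xs"
    by (simp add: secretary_rule_def)
qed

lemma picks_secretary_Y:
  assumes "i < n"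
  shows "picks (secretary_rule f m w) \<sigma> \<inter> Y i =
    picks (accepts (beats f w) (m i)) (filter (\<lambda>x. x \<in> Y i) \<sigma>)"
proof -
  let ?R = "\<lambda>xs. last xs \<in> Y i \<and> accepts (beats f w) (m i) (filter (\<lambda>x. x \<in> Y i) xs)"
  have "picks (secretary_rule f m w) \<sigma> \<inter> Y i = picks ?R \<sigma> \<inter> Y i"
    by (rule picks_cong_on)
      (use assms Y_disjoint in \<open>auto simp: secretary_rule_def last_take_Suc\<close>)
  also have "\<dots> = picks ?R \<sigma>"
    using picks_subset_if[of ?R "Y i" \<sigma>] by auto
  also have "\<dots> = picks (accepts (beats f w) (m i)) (filter (\<lambda>x. x \<in> Y i) \<sigma>)"
    by (rule picks_filter)
  finally show ?thesis .
qed

lemma picks_secretary_subset: "picks (secretary_rule f m w) \<sigma> \<subseteq> (\<Union>i<n. Y i)"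
  by (rule picks_subset_if) (auto simp: secretary_rule_def)

text \<open>The classical rule takes at most one element of each piece, and this element is not
  spanned by \<open>P i\<close>, hence independent over it.\<close>

lemma feasible_secretary: "feasible M (online_of (secretary_rule f m))"
  unfolding feasible_def selected_secretary
proof (intro allI impI)
  fix w :: "'a \<Rightarrow> real" and \<sigma>
  let ?K = "\<lambda>i. picks (secretary_rule f m w) \<sigma> \<inter> Y i"
  have "(\<Union>i<n. ?K i) \<in> indep M"
  proof (rule indep_union)
    fix i assume i: "i < n"
    have unique: "x = y" if "x \<in> ?K i" "y \<in> ?K i" for x y
      using that unfolding picks_secretary_Y[OF i]
      by (rule accepts_unique[OF beats_order(1,2)])
    then consider "?K i = {}" | x where "?K i = {x}" "x \<in> Y i" by blast
    then show "rank M (?K i \<union> P i) = card (?K i) + rank M (P i)"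
    proof cases
      case 2
      then have "rank M (insert x (P i)) = Suc (rank M (P i))"
        using Y_not_cl[OF i] Y_ground by (intro rank_insert_not_cl[OF matroid]) auto
      then show ?thesis by (simp add: 2(1))
    qed simp
  qed auto
  moreover have "(\<Union>i<n. ?K i) = picks (secretary_rule f m w) \<sigma>"
    using picks_secretary_subset[of f m w \<sigma>] by auto
  ultimately show "picks (secretary_rule f m w) \<sigma> \<in> indep M" by simp
qed

text \<open>Both \<open>f\<close> and \<open>m\<close> are chosen before the weights. Within a piece
  the event of catching the heaviest element already earns \<open>best w i\<close>, and any other
  outcome contributes a nonnegative weight.\<close>

lemma secretary_value:
  "\<exists>f m. \<forall>w. weighting M w \<longrightarrow> (\<Sum>i<n. best w i / exp 1) \<le>
    measure_pmf.expectation (pmf_of_set (permutations_of_set (ground M)))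
      (\<lambda>\<sigma>. \<Sum>x\<in>selected (online_of (secretary_rule f m)) w \<sigma>. w x)"
proof -
  obtain f :: "'a \<Rightarrow> nat" where f: "inj_on f (ground M)"
    using finite_imp_inj_to_nat_seg[OF finite_ground] by blast
  have "\<exists>m. \<forall>i. \<forall>lt b. transp lt \<longrightarrow> irreflp lt \<longrightarrow> totalp_on (Y i) lt \<longrightarrow> b \<in> Y i \<longrightarrow>
    (\<forall>y\<in>Y i. y \<noteq> b \<longrightarrow> lt y b) \<longrightarrow>
    1 / exp 1 \<le> measure_pmf.prob (pmf_of_set (permutations_of_set (Y i)))
      {\<sigma>. b \<in> picks (accepts lt (m i)) \<sigma>}"
    using ex_secretary_rule[OF finite_Y] by (intro choice allI)
  then obtain m where m: "1 / exp 1 \<le> measure_pmf.prob (pmf_of_set (permutations_of_set (Y i)))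
      {\<sigma>. b \<in> picks (accepts lt (m i)) \<sigma>}"
    if "transp lt" "irreflp lt" "totalp_on (Y i) lt" "b \<in> Y i"
      "\<forall>y\<in>Y i. y \<noteq> b \<longrightarrow> lt y b" for i b and lt :: "'a \<Rightarrow> 'a \<Rightarrow> bool"
    by blast
  show ?thesis
  proof (intro exI allI impI)
    fix w assume w: "weighting M w"
    let ?E = "measure_pmf.expectation (pmf_of_set (permutations_of_set (ground M)))"
    let ?v = "\<lambda>i \<tau>. \<Sum>x\<in>picks (accepts (beats f w) (m i)) \<tau>. w x"
    have perm_ne: "finite (permutations_of_set S)" "permutations_of_set S \<noteq> {}" if "finite S" for S :: "'a set"
      using that by auto
    have integrable: "integrable (measure_pmf (pmf_of_set (permutations_of_set S))) g"
      if "finite S" for S :: "'a set" and g :: "'a list \<Rightarrow> real"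
      using perm_ne[OF that] by (intro integrable_measure_pmf_finite) simp
    have "best w i / exp 1 \<le> ?E (\<lambda>\<sigma>. ?v i (filter (\<lambda>x. x \<in> Y i) \<sigma>))" for i
    proof -
      let ?EY = "measure_pmf.expectation (pmf_of_set (permutations_of_set (Y i)))"
      have nonneg: "0 \<le> w x" if "x \<in> picks (accepts (beats f w) (m i)) \<tau>"
        "\<tau> \<in> permutations_of_set (Y i)" for x \<tau>
        using that picks_subset Y_ground w by (force simp: weighting_def permutations_of_set_def)
      have fin: "finite (picks (accepts (beats f w) (m i)) \<tau>)" for \<tau>
        by (rule finite_subset[OF picks_subset]) simp
      have "best w i / exp 1 \<le> ?EY (?v i)"
      proof (cases "Y i = {}")
        case True
        then show ?thesis by (simp add: best_def pmf_of_set_singleton)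
      next
        case False
        have inj: "inj_on f (Y i)" using f Y_ground inj_on_subset by blast
        obtain b where b: "b \<in> Y i" "\<forall>y\<in>Y i. y \<noteq> b \<longrightarrow> beats f w y b"
          using ex_beats_max[OF finite_Y False inj] by blast
        have "w y \<le> w b" if "y \<in> Y i" for y
          using b that by (cases "y = b") (auto simp: beats_def)
        moreover have "0 \<le> w b" using b(1) Y_ground w by (auto simp: weighting_def)
        ultimately have best: "best w i = w b"
          unfolding best_def using b(1) finite_Y by (intro Max_eqI) auto
        have "1 / exp 1 \<le> measure_pmf.prob (pmf_of_set (permutations_of_set (Y i)))
            {\<tau>. b \<in> picks (accepts (beats f w) (m i)) \<tau>}"
          using beats_order(1,2) beats_order(3)[OF inj] b by (intro m)
        also have "\<dots> = ?EY (indicator {\<tau>. b \<in> picks (accepts (beats f w) (m i)) \<tau>})"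
          by simp
        finally have "best w i * (1 / exp 1) \<le>
            best w i * ?EY (indicator {\<tau>. b \<in> picks (accepts (beats f w) (m i)) \<tau>})"
          using best_ge(2) by (intro mult_left_mono)
        also have "\<dots> = ?EY (\<lambda>\<tau>. w b * indicator {\<tau>. b \<in> picks (accepts (beats f w) (m i)) \<tau>} \<tau>)"
          by (simp add: best)
        also have "\<dots> \<le> ?EY (?v i)"
        proof (rule integral_mono_AE[OF integrable[OF finite_Y] integrable[OF finite_Y]])
          show "AE \<tau> in measure_pmf (pmf_of_set (permutations_of_set (Y i))).
            w b * indicator {\<tau>. b \<in> picks (accepts (beats f w) (m i)) \<tau>} \<tau> \<le> ?v i \<tau>"
          proof (rule AE_pmfI)
            fix \<tau> assume "\<tau> \<in> set_pmf (pmf_of_set (permutations_of_set (Y i)))"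
            then have \<tau>: "\<tau> \<in> permutations_of_set (Y i)" using perm_ne[OF finite_Y] by simp
            show "w b * indicator {\<tau>. b \<in> picks (accepts (beats f w) (m i)) \<tau>} \<tau> \<le> ?v i \<tau>"
            proof (cases "b \<in> picks (accepts (beats f w) (m i)) \<tau>")
              case True
              then have "w b \<le> ?v i \<tau>"
                using fin nonneg[OF _ \<tau>] by (intro member_le_sum) auto
              then show ?thesis using True by simp
            next
              case False
              then show ?thesis using nonneg[OF _ \<tau>] by (simp add: sum_nonneg)
            qed
          qed
        qed
        finally show ?thesis by simp
      qed
      also have "\<dots> = ?E (\<lambda>\<sigma>. ?v i (filter (\<lambda>x. x \<in> Y i) \<sigma>))"
        by (subst filter_permutations_of_set[OF finite_ground Y_ground[of i], symmetric]) simp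
      finally show ?thesis .
    qed
    then have "(\<Sum>i<n. best w i / exp 1) \<le> (\<Sum>i<n. ?E (\<lambda>\<sigma>. ?v i (filter (\<lambda>x. x \<in> Y i) \<sigma>)))"
      by (intro sum_mono)
    also have "\<dots> = ?E (\<lambda>\<sigma>. \<Sum>i<n. ?v i (filter (\<lambda>x. x \<in> Y i) \<sigma>))"
      using integrable[OF finite_ground] by (intro Bochner_Integration.integral_sum[symmetric])
    also have "(\<lambda>\<sigma>. \<Sum>i<n. ?v i (filter (\<lambda>x. x \<in> Y i) \<sigma>)) =
      (\<lambda>\<sigma>. \<Sum>x\<in>selected (online_of (secretary_rule f m)) w \<sigma>. w x)"
      unfolding selected_secretary sum_Y[OF picks_secretary_subset]
      by (intro ext sum.cong refl) (simp add: picks_secretary_Y)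
    finally show "(\<Sum>i<n. best w i / exp 1) \<le>
      ?E (\<lambda>\<sigma>. \<Sum>x\<in>selected (online_of (secretary_rule f m)) w \<sigma>. w x)" .
  qed
qed

subsection \<open>The mixed algorithm\<close>

text \<open>The pieces draw their algorithms from the product measure, whose \<open>i\<close>-th
  marginal is \<open>D i\<close>, and the filtered order is uniform on \<open>C i\<close>. Linearity
  thus reduces the value to what is guaranteed on each restriction, minus the loss.\<close>

lemma main_expected_value:
  assumes c: "1 \<le> c" and D: "\<And>i. i < n \<Longrightarrow> competitive c (restriction M (C i)) (D i)"
    and w: "weighting M w"
  shows "(\<Sum>i<n. opt (restriction M (C i)) (wt w i) / c - k * best w i) \<le>
    measure_pmf.expectation (pmf_of_set (permutations_of_set (ground M)))
      (\<lambda>\<sigma>. \<integral>\<omega>. (\<Sum>x\<in>selected (online_of (main_rule \<omega>)) w \<sigma>. w x) \<partial>PiM {..<n} D)"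
proof -
  let ?E = "measure_pmf.expectation (pmf_of_set (permutations_of_set (ground M)))"
  let ?Q = "PiM {..<n} D"
  let ?f = "\<lambda>i. filter (\<lambda>x. x \<in> C i)"
  let ?g = "\<lambda>i \<sigma> A. \<Sum>x\<in>selected A (wt w i) (?f i \<sigma>). wt w i x"
  have secD: "secretary_alg (restriction M (C i)) (D i)" if "i < n" for i
    using D[OF that] by (simp add: competitive_def)
  have probD: "prob_space (D i)" and measD: "\<And>h. (\<lambda>A. A h) \<in> measurable (D i) (count_space UNIV)"
    and feasD: "\<And>A. A \<in> space (D i) \<Longrightarrow> feasible (restriction M (C i)) A" if "i < n" for i
    using secD[OF that] by (auto simp: secretary_alg_def)
  have probQ: "prob_space ?Q" using probD by (intro prob_space_PiM) auto
  interpret Q: prob_space ?Q by fact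
  have comp: "(\<lambda>\<omega>. \<omega> i) \<in> measurable ?Q (D i)" if "i < n" for i
    using that by (intro measurable_component_singleton) simp
  have measQ: "(\<lambda>\<omega>. \<omega> i h) \<in> measurable ?Q (count_space UNIV)" if "i < n" for i h
    by (rule measurable_compose[OF comp[OF that] measD[OF that]])
  have integrable: "integrable (measure_pmf (pmf_of_set (permutations_of_set (ground M)))) g"
    for g :: "'a list \<Rightarrow> real"
    using finite_ground by (intro integrable_measure_pmf_finite) simp
  have pointwise: "(\<Sum>i<n. (\<integral>A. ?g i \<sigma> A \<partial>D i) - k * best w i) \<le>
      (\<integral>\<omega>. (\<Sum>x\<in>selected (online_of (main_rule \<omega>)) w \<sigma>. w x) \<partial>?Q)"
    if \<sigma>: "\<sigma> \<in> permutations_of_set (ground M)" for \<sigma>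
  proof -
    have dist: "distinct \<sigma>" using \<sigma> by (rule permutations_of_setD)
    then have dist': "distinct (?f i \<sigma>)" for i by simp
    have "integrable ?Q (\<lambda>\<omega>. ?g i \<sigma> (\<omega> i))" if "i < n" for i
      by (rule integrable_sum_selected[OF probQ measQ[OF that] dist'])
    then have int: "integrable ?Q (\<lambda>\<omega>. ?g i \<sigma> (\<omega> i) - k * best w i)" if "i < n" for i
      using that by simp
    have comp_int: "(\<integral>\<omega>. ?g i \<sigma> (\<omega> i) \<partial>?Q) = (\<integral>A. ?g i \<sigma> A \<partial>D i)" if "i < n" for i
    proof -
      have "(\<integral>A. ?g i \<sigma> A \<partial>distr ?Q (D i) (\<lambda>\<omega>. \<omega> i)) = (\<integral>\<omega>. ?g i \<sigma> (\<omega> i) \<partial>?Q)"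
        by (rule integral_distr[OF comp[OF that]]) (rule measurable_sum_selected[OF measD[OF that] dist'])
      moreover have "distr ?Q (D i) (\<lambda>\<omega>. \<omega> i) = D i"
        using probD that by (intro distr_PiM_component) auto
      ultimately show ?thesis by simp
    qed
    have "(\<Sum>i<n. (\<integral>A. ?g i \<sigma> A \<partial>D i) - k * best w i) =
        (\<Sum>i<n. \<integral>\<omega>. ?g i \<sigma> (\<omega> i) - k * best w i \<partial>?Q)"
    proof (rule sum.cong[OF refl])
      fix i assume "i \<in> {..<n}"
      then have i: "i < n" by simp
      have "integrable ?Q (\<lambda>\<omega>. ?g i \<sigma> (\<omega> i))"
        by (rule integrable_sum_selected[OF probQ measQ[OF i] dist'])
      then show "(\<integral>A. ?g i \<sigma> A \<partial>D i) - k * best w i = (\<integral>\<omega>. ?g i \<sigma> (\<omega> i) - k * best w i \<partial>?Q)"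
        by (simp add: comp_int[OF i] Q.prob_space)
    qed
    also have "\<dots> = (\<integral>\<omega>. (\<Sum>i<n. ?g i \<sigma> (\<omega> i) - k * best w i) \<partial>?Q)"
      using int by (intro Bochner_Integration.integral_sum[symmetric]) auto
    also have "\<dots> \<le> (\<integral>\<omega>. (\<Sum>x\<in>selected (online_of (main_rule \<omega>)) w \<sigma>. w x) \<partial>?Q)"
    proof (rule integral_mono)
      show "integrable ?Q (\<lambda>\<omega>. \<Sum>i<n. ?g i \<sigma> (\<omega> i) - k * best w i)"
        using int by (intro Bochner_Integration.integrable_sum) auto
      show "integrable ?Q (\<lambda>\<omega>. \<Sum>x\<in>selected (online_of (main_rule \<omega>)) w \<sigma>. w x)"
        by (rule integrable_sum_selected[OF probQ measurable_main[OF measQ] dist])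
      fix \<omega> assume \<omega>: "\<omega> \<in> space ?Q"
      have "feasible (restriction M (C i)) (\<omega> i)" if "i < n" for i
        using \<omega> that by (intro feasD[OF that]) (auto simp: space_PiM)
      then show "(\<Sum>i<n. ?g i \<sigma> (\<omega> i) - k * best w i) \<le>
          (\<Sum>x\<in>selected (online_of (main_rule \<omega>)) w \<sigma>. w x)"
        by (rule main_value[OF _ w \<sigma>])
    qed
    finally show ?thesis .
  qed
  have "opt (restriction M (C i)) (wt w i) / c \<le> ?E (\<lambda>\<sigma>. \<integral>A. ?g i \<sigma> A \<partial>D i)" if "i < n" for i
  proof -
    have "opt (restriction M (C i)) (wt w i) / c \<le> alg_value (restriction M (C i)) (D i) (wt w i)"
      using D[OF that] weighting_wt[OF w] by (simp add: competitive_def)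
    also have "\<dots> = ?E (\<lambda>\<sigma>. \<integral>A. ?g i \<sigma> A \<partial>D i)"
      unfolding alg_value_def ground_restriction
      by (subst filter_permutations_of_set[OF finite_ground C_ground[of i], symmetric]) simp
    finally show ?thesis .
  qed
  then have "(\<Sum>i<n. opt (restriction M (C i)) (wt w i) / c - k * best w i) \<le>
      (\<Sum>i<n. ?E (\<lambda>\<sigma>. \<integral>A. ?g i \<sigma> A \<partial>D i) - k * best w i)"
    by (intro sum_mono diff_mono) auto
  also have "\<dots> = (\<Sum>i<n. ?E (\<lambda>\<sigma>. (\<integral>A. ?g i \<sigma> A \<partial>D i) - k * best w i))"
    using integrable by simp
  also have "\<dots> = ?E (\<lambda>\<sigma>. \<Sum>i<n. (\<integral>A. ?g i \<sigma> A \<partial>D i) - k * best w i)"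
    by (intro Bochner_Integration.integral_sum[symmetric] integrable)
  also have "\<dots> \<le> ?E (\<lambda>\<sigma>. \<integral>\<omega>. (\<Sum>x\<in>selected (online_of (main_rule \<omega>)) w \<sigma>. w x) \<partial>?Q)"
    using pointwise finite_ground
    by (intro integral_mono_AE integrable AE_pmfI) simp
  finally show ?thesis .
qed

theorem ex_competitive:
  assumes c: "1 \<le> c" and D: "\<And>i. i < n \<Longrightarrow> competitive c (restriction M (C i)) (D i)"
  shows "\<exists>D'. competitive (c * (1 + k * exp 1)) M D'"
proof -
  obtain f m where sec: "\<And>w. weighting M w \<Longrightarrow> (\<Sum>i<n. best w i / exp 1) \<le>
    measure_pmf.expectation (pmf_of_set (permutations_of_set (ground M)))
      (\<lambda>\<sigma>. \<Sum>x\<in>selected (online_of (secretary_rule f m)) w \<sigma>. w x)"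
    using secretary_value by blast
  define q :: real where "q = 1 / (1 + k * exp 1)"
  have den: "0 < 1 + k * exp (1::real)" by (simp add: add_pos_nonneg)
  have q: "0 < q" "q \<le> 1" using den by (auto simp: q_def divide_le_eq)
  have q': "1 - q = q * k * exp 1" using den by (simp add: q_def field_simps)
  have secD: "secretary_alg (restriction M (C i)) (D i)" if "i < n" for i
    using D[OF that] by (simp add: competitive_def)
  have "prob_space (PiM {..<n} D)"
    using secD by (intro prob_space_PiM) (auto simp: secretary_alg_def)
  moreover have "feasible M (online_of (main_rule \<omega>))" if "\<omega> \<in> space (PiM {..<n} D)" for \<omega>
    using that secD by (intro feasible_main) (auto simp: space_PiM secretary_alg_def)
  moreover have "(\<lambda>\<omega>. online_of (main_rule \<omega>) h) \<in> measurable (PiM {..<n} D) (count_space UNIV)" for h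
  proof (rule measurable_main)
    fix i h assume i: "i < n"
    then have "(\<lambda>\<omega>. \<omega> i) \<in> measurable (PiM {..<n} D) (D i)"
      by (intro measurable_component_singleton) simp
    moreover have "(\<lambda>A. A h) \<in> measurable (D i) (count_space UNIV)"
      using secD[OF i] by (simp add: secretary_alg_def)
    ultimately show "(\<lambda>\<omega>. \<omega> i h) \<in> measurable (PiM {..<n} D) (count_space UNIV)"
      by (rule measurable_compose)
  qed
  ultimately obtain D' where D': "secretary_alg M D'" "\<And>w. alg_value M D' w =
    (1 - q) * measure_pmf.expectation (pmf_of_set (permutations_of_set (ground M)))
      (\<lambda>\<sigma>. \<Sum>x\<in>selected (online_of (secretary_rule f m)) w \<sigma>. w x) +
    (1 - (1 - q)) * measure_pmf.expectation (pmf_of_set (permutations_of_set (ground M)))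
      (\<lambda>\<sigma>. \<integral>\<omega>. (\<Sum>x\<in>selected (online_of (main_rule \<omega>)) w \<sigma>. w x) \<partial>PiM {..<n} D)"
    using ex_mixed_alg[OF finite_ground, of "PiM {..<n} D" "\<lambda>\<omega>. online_of (main_rule \<omega>)"
        "online_of (secretary_rule f m)" "1 - q"] feasible_secretary q by auto
  have "1 / (c * (1 + k * exp 1)) * opt M w \<le> alg_value M D' w" if w: "weighting M w" for w
  proof -
    let ?o = "\<lambda>i. opt (restriction M (C i)) (wt w i)"
    have "1 / (c * (1 + k * exp 1)) * opt M w = q / c * opt M w" by (simp add: q_def)
    also have "\<dots> \<le> q / c * (\<Sum>i<n. ?o i)"
      using opt_le_sum_opt q c by (intro mult_left_mono) auto
    \<comment> \<open>The choice of \<open>q\<close> gives \<open>(1 - q) / e = q * k\<close>, so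
      the two \<open>best\<close> terms cancel.\<close>
    also have "\<dots> = (1 - q) * (\<Sum>i<n. best w i / exp 1) + q * (\<Sum>i<n. ?o i / c - k * best w i)"
      by (simp add: q' sum_subtractf right_diff_distrib flip: sum_divide_distrib sum_distrib_left)
    also have "\<dots> \<le> alg_value M D' w"
      unfolding D'(2) using sec[OF w] main_expected_value[OF c D w] q
      by (intro add_mono mult_left_mono) auto
    finally show ?thesis .
  qed
  with D'(1) show ?thesis by (auto simp: competitive_def)
qed

end

section \<open>From the tree-decomposition to a sequence of pieces\<close>

text \<open>The empty set makes the optimum nonnegative, so a larger ratio is a weaker
  demand.\<close>

lemma competitive_mono:
  assumes M: "matroid M" and c: "0 < c" "c \<le> c'" and D: "competitive c M D"
  shows "competitive c' M D"
  unfolding competitive_def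
proof (intro conjI allI impI)
  show "secretary_alg M D" using D by (simp add: competitive_def)
  fix w assume w: "weighting M w"
  have "(\<Sum>x\<in>{}. w x) \<in> (\<lambda>I. \<Sum>x\<in>I. w x) ` indep M"
    using empty_indep[OF M] by (rule imageI)
  then have "(\<Sum>x\<in>{}. w x) \<le> opt M w"
    unfolding opt_def using finite_indep[OF M] by (intro Max_ge) auto
  then have "1 / c' * opt M w \<le> 1 / c * opt M w"
    using c by (intro mult_right_mono) (auto simp: frac_le)
  also have "\<dots> \<le> alg_value M D w" using D w by (simp add: competitive_def)
  finally show "1 / c' * opt M w \<le> alg_value M D w" .
qed

text \<open>Fullness closes a chain of inequalities. The connectivity of a part to its parent is at
  most that to all earlier parts, which is at most the thickness of the parent edge, since the edge
  separates the two; by fullness this thickness is the connectivity to the parent.\<close>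

lemma full_decomposition_sequence:
  assumes M: "matroid M" and full: "full_tree_decomposition M V F X"
    and thick: "thickness M F X \<le> int k"
  obtains vs P where "set vs = V" "piece_sequence M (\<lambda>i. X (vs ! i)) P (length vs) k"
proof -
  have tree: "is_tree V F" and disj: "disjoint_family_on X V" and UN: "(\<Union>v\<in>V. X v) = ground M"
    and fullE: "\<And>u v. {u, v} \<in> F \<Longrightarrow> local_conn M (X u) (X v) = edge_thickness M F X u v"
    using full by (auto simp: full_tree_decomposition_def tree_decomposition_def)
  obtain vs where vs: "distinct vs" "set vs = V"
    and grow: "\<And>i. 0 < i \<Longrightarrow> i < length vs \<Longrightarrow> \<exists>j<i. {vs ! j, vs ! i} \<in> F \<and>
      set (take i vs) \<subseteq> component (F - {{vs ! j, vs ! i}}) (vs ! j) \<and>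
      vs ! i \<notin> component (F - {{vs ! j, vs ! i}}) (vs ! j)"
    using tree_enumeration[OF tree] by metis
  have simple: "finite V" "\<And>f. f \<in> F \<Longrightarrow> f \<subseteq> V"
    using tree by (auto simp: is_tree_def simple_graph_def)
  have thick_edge: "edge_thickness M F X u v \<le> int k" if "{u, v} \<in> F" for u v
  proof -
    \<comment> \<open>\<open>Max\<close> bounds its elements only on a finite set, and finiteness
      comes from indexing the edges by \<open>V \<times> V\<close>.\<close>
    have "{edge_thickness M F X u v |u v. {u, v} \<in> F} \<subseteq>
        (\<lambda>(u, v). edge_thickness M F X u v) ` (V \<times> V)"
      using simple(2) by fastforce
    then have "finite {edge_thickness M F X u v |u v. {u, v} \<in> F}"
      using simple(1) by (meson finite_SigmaI finite_imageI finite_subset)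
    then have "edge_thickness M F X u v \<le> thickness M F X"
      unfolding thickness_def using that by (intro Max_ge) auto
    then show ?thesis using thick by linarith
  qed
  define E where "E i = (\<Union>j<i. X (vs ! j))" for i
  have "\<exists>p. (p = {} \<or> (\<exists>j<i. p = X (vs ! j))) \<and>
      local_conn M (X (vs ! i)) (E i) = local_conn M (X (vs ! i)) p \<and>
      local_conn M (X (vs ! i)) p \<le> int k" if i: "i < length vs" for i
  proof (cases "i = 0")
    case True
    then show ?thesis
      by (intro exI[of _ "{}"]) (simp add: E_def local_conn_def rank_empty[OF M])
  next
    case False
    with grow[of i] i obtain j where j: "j < i" and e: "{vs ! j, vs ! i} \<in> F"
      and sub: "set (take i vs) \<subseteq> component (F - {{vs ! j, vs ! i}}) (vs ! j)"
      and notin: "vs ! i \<notin> component (F - {{vs ! j, vs ! i}}) (vs ! j)" by blast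
    define K where "K = component (F - {{vs ! j, vs ! i}}) (vs ! j)"
    define Z where "Z = (\<Union>x\<in>K. X x)"
    have "K \<subseteq> V"
    proof -
      have "K \<subseteq> component F (vs ! j)" unfolding K_def by (rule component_mono) auto
      moreover have "vs ! j \<in> V" using vs i j by auto
      ultimately show ?thesis using tree by (auto simp: is_tree_def)
    qed
    have "X (vs ! i) \<inter> X v = {}" if "v \<in> K" for v
      using disj vs i that \<open>K \<subseteq> V\<close> notin unfolding K_def[symmetric]
      by (intro disjoint_family_onD[OF disj]) auto
    then have "X (vs ! i) \<inter> Z = {}" by (auto simp: Z_def)
    then have Xi: "X (vs ! i) \<subseteq> ground M - Z"
      using UN vs i nth_mem by blast
    have "vs ! l \<in> K" if "l < i" for l
    proof -
      have "vs ! l \<in> set (take i vs)" using that i by (auto simp: in_set_conv_nth)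
      then show ?thesis using sub K_def by auto
    qed
    then have "E i \<subseteq> Z" by (auto simp: E_def Z_def)
    have Xj: "X (vs ! j) \<subseteq> E i" using j by (auto simp: E_def)
    have "local_conn M (X (vs ! i)) (E i) \<le> local_conn M (ground M - Z) Z"
      by (rule local_conn_mono[OF M Xi \<open>E i \<subseteq> Z\<close>])
    also have "\<dots> = edge_thickness M F X (vs ! j) (vs ! i)"
      using local_conn_commute[OF M] by (simp add: edge_thickness_def conn_def Z_def K_def)
    also have "\<dots> = local_conn M (X (vs ! i)) (X (vs ! j))"
      using fullE[OF e] local_conn_commute[OF M] by simp
    finally have "local_conn M (X (vs ! i)) (E i) = local_conn M (X (vs ! i)) (X (vs ! j))"
      using local_conn_mono[OF M subset_refl Xj, of "X (vs ! i)"] by simp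
    moreover have "local_conn M (X (vs ! i)) (X (vs ! j)) \<le> int k"
      using thick_edge[OF e] fullE[OF e] local_conn_commute[OF M] by metis
    ultimately show ?thesis using j by (intro exI[of _ "X (vs ! j)"]) auto
  qed
  then obtain P where P: "\<And>i. i < length vs \<Longrightarrow> (P i = {} \<or> (\<exists>j<i. P i = X (vs ! j))) \<and>
      local_conn M (X (vs ! i)) (E i) = local_conn M (X (vs ! i)) (P i) \<and>
      local_conn M (X (vs ! i)) (P i) \<le> int k"
    by metis
  have "piece_sequence M (\<lambda>i. X (vs ! i)) P (length vs) k"
  proof
    show "X (vs ! i) \<subseteq> ground M" if "i < length vs" for i using that UN vs by auto
    show "ground M \<subseteq> (\<Union>i<length vs. X (vs ! i))"
    proof
      fix x assume "x \<in> ground M"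
      then obtain v where "v \<in> set vs" "x \<in> X v" using UN vs(2) by auto
      then show "x \<in> (\<Union>i<length vs. X (vs ! i))" by (auto simp: in_set_conv_nth)
    qed
  qed (use M P in \<open>auto simp: E_def\<close>)
  then show ?thesis using that vs(2) by blast
qed

theorem theorem4p2:
  fixes c :: real and k :: nat and \<M> :: "'a matroid_system set"
  assumes "1 \<le> c"
    and "\<And>M. M \<in> \<M> \<Longrightarrow> matroid M"
    and "\<And>M. M \<in> \<M> \<Longrightarrow> \<exists>D. competitive c M D"
  shows "\<forall>M \<in> t_class TYPE('v) k \<M>. \<exists>D. competitive (c * (exp 1 + 1) ^ k) M D"
proof
  fix M assume "M \<in> t_class TYPE('v) k \<M>"
  then obtain V :: "'v set" and F X where M: "matroid M" and full: "full_tree_decomposition M V F X"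
    and thick: "thickness M F X \<le> int k" and X: "\<And>v. v \<in> V \<Longrightarrow> restriction M (cl M (X v)) \<in> \<M>"
    by (auto simp: t_class_def)
  obtain vs P where vs: "set vs = V" "piece_sequence M (\<lambda>i. X (vs ! i)) P (length vs) k"
    using full_decomposition_sequence[OF M full thick] .
  interpret piece_sequence M "\<lambda>i. X (vs ! i)" P "length vs" k by fact
  have "\<exists>D. competitive c (restriction M (C i)) D" if "i < length vs" for i
    unfolding C_def using that vs(1) by (intro assms(3) X) auto
  then obtain D where "\<And>i. i < length vs \<Longrightarrow> competitive c (restriction M (C i)) (D i)" by metis
  from ex_competitive[OF assms(1) this]
  obtain D' where D': "competitive (c * (1 + k * exp 1)) M D'" by blast
  have "1 + k * exp 1 \<le> (1 + exp (1::real)) ^ k"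
    by (rule Bernoulli_inequality) (use exp_ge_zero[of 1] in linarith)
  then have "c * (1 + k * exp 1) \<le> c * (exp 1 + 1) ^ k"
    using assms(1) by (intro mult_left_mono) (auto simp: add.commute)
  moreover have "0 < c * (1 + k * exp 1)"
    using assms(1) by (intro mult_pos_pos) (auto intro: add_pos_nonneg)
  ultimately show "\<exists>D. competitive (c * (exp 1 + 1) ^ k) M D"
    using competitive_mono[OF M _ _ D'] by blast
qed

end
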